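(* Let $F$ be a field, let $R$ be an $F$-algebra and let $\mathcal{F}=(\mathcal{F}_i)_{i\geq 0}$ be a finite-dimensional filtration of $R$. If the associated graded algebra $\operatorname{gr}_{\mathcal{F}}(R)$ is Noetherian, then $R$ is finitely presented as an $F$-algebra.
   Context: Algebras are associative and unital, not necessarily commutative. Noetherian means left and right Noetherian. A finite-dimensional filtration of an $F$-algebra $R$ is an ascending chain of $F$-subspaces $F\subseteq \mathcal{F}_0\subseteq \mathcal{F}_1\subseteq\cdots$ of $R$ such that $\dim_F\mathcal{F}_i<\infty$ and $\mathcal{F}_i\mathcal{F}_j\subseteq\mathcal{F}_{i+j}$ for all $i,j\geq 0$; all filtrations are assumed exhaustive, i.e. $R=\bigcup_{i\geq 0}\mathcal{F}_i$. The associated graded algebra is $\operatorname{gr}_{\mathcal{F}}(R)=\mathcal{F}_0\oplus\mathcal{F}_1/\mathcal{F}_0\oplus\mathcal{F}_2/\mathcal{F}_1\oplus\cdots$ with the induced multiplication. An $F$-algebra is finitely presented if it is isomorphic to $F\langle x_1,\dots,x_n\rangle/I$ for some $n$, where $F\langle x_1,\dots,x_n\rangle$ is the free associative algebra and $I$ is a two-sided ideal that is finitely generated as a two-sided ideal. *)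

theory Defs
  imports "HOL-Algebra.QuotRing" "Jordan_Normal_Form.Missing_VectorSpace"
begin

section \<open>Associative algebras over a field\<close>

text \<open>The locale \<^locale>\<open>algebra\<close> of HOL-Algebra requires the algebra to be a commutative ring, so
  associative unital algebras are set up here. The zero ring is not excluded.\<close>

locale assoc_algebra = vectorspace K A + ring A for K and A (structure) +
  assumes smult_mult_left:
      "\<lbrakk>c \<in> carrier K; x \<in> carrier A; y \<in> carrier A\<rbrakk> \<Longrightarrow> (c \<odot> x) \<otimes> y = c \<odot> (x \<otimes> y)"
    and smult_mult_right:
      "\<lbrakk>c \<in> carrier K; x \<in> carrier A; y \<in> carrier A\<rbrakk> \<Longrightarrow> x \<otimes> (c \<odot> y) = c \<odot> (x \<otimes> y)"

definition alg_iso ::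
    "('k, 'm) ring_scheme \<Rightarrow> ('k, 'a, 'p) module_scheme \<Rightarrow> ('k, 'b, 'q) module_scheme \<Rightarrow> ('a \<Rightarrow> 'b) set"
  where "alg_iso K A B =
    {h \<in> ring_iso A B. \<forall>c \<in> carrier K. \<forall>x \<in> carrier A. h (c \<odot>\<^bsub>A\<^esub> x) = c \<odot>\<^bsub>B\<^esub> h x}"


section \<open>Left and right Noetherian rings\<close>

text \<open>The library's \<^locale>\<open>ideal\<close> is a two-sided ideal, and its locale \<open>noetherian_ring\<close> is
  about two-sided ideals only.\<close>

locale left_ideal = additive_subgroup I R + ring R for I and R (structure) +
  assumes l_closed: "\<lbrakk>a \<in> I; x \<in> carrier R\<rbrakk> \<Longrightarrow> x \<otimes> a \<in> I"

locale right_ideal = additive_subgroup I R + ring R for I and R (structure) +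
  assumes r_closed: "\<lbrakk>a \<in> I; x \<in> carrier R\<rbrakk> \<Longrightarrow> a \<otimes> x \<in> I"

definition genleftideal :: "('a, 'm) ring_scheme \<Rightarrow> 'a set \<Rightarrow> 'a set"
  where "genleftideal R S = \<Inter>{I. left_ideal I R \<and> S \<subseteq> I}"

definition genrightideal :: "('a, 'm) ring_scheme \<Rightarrow> 'a set \<Rightarrow> 'a set"
  where "genrightideal R S = \<Inter>{I. right_ideal I R \<and> S \<subseteq> I}"

locale left_right_noetherian_ring = ring +
  assumes left_fin_gen:
      "left_ideal I R \<Longrightarrow> \<exists>S \<subseteq> carrier R. finite S \<and> I = genleftideal R S"
    and right_fin_gen:
      "right_ideal I R \<Longrightarrow> \<exists>S \<subseteq> carrier R. finite S \<and> I = genrightideal R S"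


section \<open>Filtrations and associated graded algebras\<close>

text \<open>The inclusion of the ground field in \<open>Fil 0\<close> is expressed through the structure map
  \<open>c \<mapsto> c \<odot> \<one>\<close>.\<close>

locale fin_dim_filtration = assoc_algebra K A for K and A (structure) +
  fixes Fil :: "nat \<Rightarrow> _ set"
  assumes Fil_subspace: "subspace K (Fil i) A"
    and Fil_fin_dim: "vectorspace.fin_dim K (A\<lparr>carrier := Fil i\<rparr>)"
    and Fil_scalars: "c \<in> carrier K \<Longrightarrow> c \<odot> \<one> \<in> Fil 0"
    and Fil_ascending: "Fil i \<subseteq> Fil (Suc i)"
    and Fil_mult: "\<lbrakk>x \<in> Fil i; y \<in> Fil j\<rbrakk> \<Longrightarrow> x \<otimes> y \<in> Fil (i + j)"
    and Fil_exhaustive: "carrier A = (\<Union>i. Fil i)"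

text \<open>\<open>Fil_pred A Fil i\<close> is the filtration step of index \<open>i - 1\<close>, read as the zero subspace for
  \<open>i = 0\<close>.\<close>

definition Fil_pred :: "('a, 'm) ring_scheme \<Rightarrow> (nat \<Rightarrow> 'a set) \<Rightarrow> nat \<Rightarrow> 'a set"
  where "Fil_pred A Fil i = (case i of 0 \<Rightarrow> {\<zero>\<^bsub>A\<^esub>} | Suc j \<Rightarrow> Fil j)"

definition gr_piece :: "('a, 'm) ring_scheme \<Rightarrow> (nat \<Rightarrow> 'a set) \<Rightarrow> nat \<Rightarrow> 'a set monoid"
  where "gr_piece A Fil i = (A\<lparr>carrier := Fil i\<rparr>) A_Mod (Fil_pred A Fil i)"

text \<open>An element of the associated graded algebra is a finitely supported sequence whose \<open>i\<close>-th
  component is a coset in \<open>Fil i / Fil (i - 1)\<close>. The additive group \<^const>\<open>gr_piece\<close> is written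
  multiplicatively, as a \<^const>\<open>FactGroup\<close>, so its \<^const>\<open>finprod\<close> is a sum of cosets;
  \<open>rcoset_mult A (Fil_pred A Fil (i + j))\<close> is the multiplication
  \<open>Fil i / Fil (i - 1) \<times> Fil j / Fil (j - 1) \<rightarrow> Fil (i + j) / Fil (i + j - 1)\<close>.\<close>

definition assoc_graded ::
    "('k, 'a, 'm) module_scheme \<Rightarrow> (nat \<Rightarrow> 'a set) \<Rightarrow> ('k, nat \<Rightarrow> 'a set) module"
  where "assoc_graded A Fil =
    \<lparr>carrier = {x. (\<forall>i. x i \<in> carrier (gr_piece A Fil i)) \<and> finite {i. x i \<noteq> Fil_pred A Fil i}},
     mult = (\<lambda>x y n. finprod (gr_piece A Fil n)
               (\<lambda>i. rcoset_mult A (Fil_pred A Fil n) (x i) (y (n - i))) {..n}),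
     one = (\<lambda>i. if i = 0 then Fil_pred A Fil 0 +>\<^bsub>A\<^esub> \<one>\<^bsub>A\<^esub> else Fil_pred A Fil i),
     zero = Fil_pred A Fil,
     add = (\<lambda>x y i. x i <+>\<^bsub>A\<^esub> y i),
     smult = (\<lambda>c x i. \<Union>a \<in> x i. Fil_pred A Fil i +>\<^bsub>A\<^esub> (c \<odot>\<^bsub>A\<^esub> a))\<rparr>"


section \<open>Finitely presented algebras\<close>

text \<open>The free associative algebra on \<open>n\<close> generators: words are lists over \<open>{..<n}\<close>, and \<open>p w\<close> is
  the coefficient of the word \<open>w\<close> in \<open>p\<close>. The coefficient of \<open>w\<close> in a product runs over the
  factorizations \<open>w = take i w @ drop i w\<close>.\<close>

definition free_algebra :: "('k, 'm) ring_scheme \<Rightarrow> nat \<Rightarrow> ('k, nat list \<Rightarrow> 'k) module"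
  where "free_algebra K n =
    \<lparr>carrier = {p. (\<forall>w. p w \<in> carrier K) \<and> finite {w. p w \<noteq> \<zero>\<^bsub>K\<^esub>}
                 \<and> (\<forall>w. p w \<noteq> \<zero>\<^bsub>K\<^esub> \<longrightarrow> set w \<subseteq> {..<n})},
     mult = (\<lambda>p q w. \<Oplus>\<^bsub>K\<^esub>i \<in> {..length w}. p (take i w) \<otimes>\<^bsub>K\<^esub> q (drop i w)),
     one = (\<lambda>w. if w = [] then \<one>\<^bsub>K\<^esub> else \<zero>\<^bsub>K\<^esub>),
     zero = (\<lambda>w. \<zero>\<^bsub>K\<^esub>),
     add = (\<lambda>p q w. p w \<oplus>\<^bsub>K\<^esub> q w),
     smult = (\<lambda>c p w. c \<otimes>\<^bsub>K\<^esub> p w)\<rparr>"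

definition quot_algebra :: "('k, 'a, 'm) module_scheme \<Rightarrow> 'a set \<Rightarrow> ('k, 'a set) module"
  where "quot_algebra A I =
    \<lparr>carrier = carrier (A Quot I), mult = mult (A Quot I), one = one (A Quot I),
     zero = zero (A Quot I), add = add (A Quot I),
     smult = (\<lambda>c X. \<Union>x \<in> X. I +>\<^bsub>A\<^esub> (c \<odot>\<^bsub>A\<^esub> x))\<rparr>"

definition finitely_presented_algebra ::
    "('k, 'm) ring_scheme \<Rightarrow> ('k, 'a, 'p) module_scheme \<Rightarrow> bool"
  where "finitely_presented_algebra K A \<longleftrightarrow>
    (\<exists>n I. ideal I (free_algebra K n)
       \<and> (\<exists>S \<subseteq> carrier (free_algebra K n). finite S \<and> I = genideal (free_algebra K n) S)
       \<and> alg_iso K A (quot_algebra (free_algebra K n) I) \<noteq> {})"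

end

theory Submission
  imports Defs
begin

text \<open>Write \<open>gr\<close> for the associated graded ring. Only left ideals of \<open>gr\<close> matter. The positive part of
  \<open>gr\<close> is a left ideal, so it is generated by symbols of finitely many \<open>y\<^sub>1, \<dots>, y\<^sub>m\<close> with \<open>y\<^sub>j\<close> of degree
  \<open>d\<^sub>j \<ge> 1\<close>; in terms of the filtration, \<open>F n = F (n - 1) + (\<Sum>j. F (n - d\<^sub>j) y\<^sub>j)\<close> for \<open>n \<ge> 1\<close>. For each \<open>j\<close> the
  symbols that multiply \<open>y\<^sub>j\<close> into the left ideal generated by \<open>y\<^sub>j\<^sub>+\<^sub>1, \<dots>, y\<^sub>m\<close> form a left ideal of \<open>gr\<close> as
  well, again finitely generated. So finitely many relations control the
  syzygies among the \<open>y\<^sub>j\<close>, with no need for submodules of a free module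
  (\<open>left_stable_fin_gen\<close>, \<open>bounded_syz_exists\<close>).

  Let \<open>e\<close> bound the degrees of all these generators and relations. Let \<open>P\<close> be a free algebra on
  generators that map to a spanning set of \<open>F e\<close>, and let \<open>J\<close> be the ideal generated by the relations
  that are combinations of words of length at most two. These relations form a finite-dimensional space,
  so \<open>J\<close> is finitely generated. The claim is that \<open>J\<close> is the whole kernel of \<open>P \<rightarrow> A\<close>.

  Filter \<open>P\<close> by weight: an element has weight \<open>n\<close> if, modulo \<open>J\<close>, it is a sum of products of linear
  forms whose values lie in \<open>F a\<^sub>1, \<dots>, F a\<^sub>k\<close> with \<open>a\<^sub>i \<le> e\<close> and \<open>a\<^sub>1 + \<dots> + a\<^sub>k \<le> n\<close>. Up to weight \<open>e\<close> every element
  is congruent to a linear form, so there the kernel lies in \<open>J\<close>. For a kernel element \<open>p\<close> of weight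
  \<open>n > e\<close> write \<open>p = v + (\<Sum>j. u\<^sub>j Y\<^sub>j)\<close>, where \<open>v\<close> has weight \<open>n - 1\<close>, \<open>Y\<^sub>j\<close> is a lift of \<open>y\<^sub>j\<close> and \<open>u\<^sub>j\<close> has weight
  \<open>n - d\<^sub>j\<close> (\<open>decomposition\<close>). The value of the leading \<open>u\<^sub>j\<close> lies in the span of the finitely many syzygy
  generators; by induction on the weight \<open>u\<^sub>j\<close> is congruent to a combination of their lifts, and each
  lift times \<open>Y\<^sub>j\<close> can be rewritten by a relation of weight at most \<open>e\<close>. This removes the summands one by
  one until \<open>p\<close> has weight \<open>n - 1\<close>, and induction finishes (\<open>weight_kernel\<close>).\<close>

section \<open>Filtrations and syzygies\<close>

text \<open>A filtration indexed by the integers, so that \<open>F (n - d)\<close> makes sense for all \<open>n\<close> and \<open>d\<close>. The locale is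
  used both for \<open>A\<close> and for the free algebra that presents it; the two differ in negative degrees, where
  the filtration is zero in the first case and an ideal in the second.\<close>

locale int_filtration = ring A for A (structure) +
  fixes F :: "int \<Rightarrow> 'a set"
  assumes F_subgroup: "additive_subgroup (F n) A"
    and F_step: "F n \<subseteq> F (n + 1)"
    and F_mult: "\<lbrakk>x \<in> F m; y \<in> F n\<rbrakk> \<Longrightarrow> x \<otimes> y \<in> F (m + n)"
begin

lemma F_carrier: "x \<in> F n \<Longrightarrow> x \<in> carrier A"
  by (rule additive_subgroup.a_Hcarr[OF F_subgroup])

lemma F_zero: "\<zero> \<in> F n"
  by (rule additive_subgroup.zero_closed[OF F_subgroup])

lemma F_add: "\<lbrakk>x \<in> F n; y \<in> F n\<rbrakk> \<Longrightarrow> x \<oplus> y \<in> F n"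
  by (rule additive_subgroup.a_closed[OF F_subgroup])

lemma F_neg: "x \<in> F n \<Longrightarrow> \<ominus> x \<in> F n"
  by (rule additive_subgroup.a_inv_closed[OF F_subgroup])

lemma F_minus: "\<lbrakk>x \<in> F n; y \<in> F n\<rbrakk> \<Longrightarrow> x \<ominus> y \<in> F n"
  unfolding a_minus_def by (intro F_add F_neg)

lemma F_mono:
  assumes "m \<le> n" "x \<in> F m"
  shows "x \<in> F n"
proof -
  have "x \<in> F (m + int k)" for k
  proof (induction k)
    case (Suc k)
    then show ?case using F_step[of "m + int k"] by (auto simp: ac_simps)
  qed (simp add: assms)
  from this[of "nat (n - m)"] show ?thesis using assms(1) by simp
qed

text \<open>For a list of elements \<open>y\<close> with degrees \<open>d\<close>, the set \<open>hspan ys n\<close> is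
  \<open>F (n - 1) + (\<Sum>(y, d) \<leftarrow> ys. F (n - d) y)\<close>. If each \<open>y\<close> lies in \<open>F d\<close>, these are the elements of \<open>F n\<close> whose
  symbol lies in the left ideal generated by the symbols of the list. The recursion makes the head of the list its leading generator.\<close>

fun hspan :: "('a \<times> int) list \<Rightarrow> int \<Rightarrow> 'a set" where
  "hspan [] n = F (n - 1)"
| "hspan ((y, d) # ys) n = {u \<otimes> y \<oplus> h |u h. u \<in> F (n - d) \<and> h \<in> hspan ys n}"

lemma hspan_ConsI:
  "\<lbrakk>x = u \<otimes> y \<oplus> h; u \<in> F (n - d); h \<in> hspan ys n\<rbrakk> \<Longrightarrow> x \<in> hspan ((y, d) # ys) n"
  by auto

lemma hspan_carrier:
  "fst ` set ys \<subseteq> carrier A \<Longrightarrow> x \<in> hspan ys n \<Longrightarrow> x \<in> carrier A"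
  by (induction ys n arbitrary: x rule: hspan.induct) (auto dest: F_carrier)

lemma hspan_base:
  assumes "fst ` set ys \<subseteq> carrier A" "x \<in> F (n - 1)"
  shows "x \<in> hspan ys n"
  using assms
proof (induction ys)
  case (Cons p ys)
  obtain y d where p: "p = (y, d)" by (cases p)
  have "x = \<zero> \<otimes> y \<oplus> x" using Cons.prems p F_carrier by simp
  moreover have "x \<in> hspan ys n" using Cons by simp
  ultimately show ?case unfolding p using F_zero by (intro hspan_ConsI)
qed simp

lemma hspan_add:
  assumes "fst ` set ys \<subseteq> carrier A" "x \<in> hspan ys n" "y \<in> hspan ys n"
  shows "x \<oplus> y \<in> hspan ys n"
  using assms
proof (induction ys arbitrary: x y)
  case (Cons p ys)
  obtain z d where p: "p = (z, d)" by (cases p)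
  from Cons.prems p obtain u h u' h' where
    x: "x = u \<otimes> z \<oplus> h" "u \<in> F (n - d)" "h \<in> hspan ys n" and
    y: "y = u' \<otimes> z \<oplus> h'" "u' \<in> F (n - d)" "h' \<in> hspan ys n" by auto
  have c: "u \<in> carrier A" "u' \<in> carrier A" "z \<in> carrier A" "h \<in> carrier A" "h' \<in> carrier A"
    using x y F_carrier hspan_carrier Cons.prems p by auto
  have "x \<oplus> y = (u \<oplus> u') \<otimes> z \<oplus> (h \<oplus> h')"
    unfolding x(1) y(1) using c by algebra
  moreover have "h \<oplus> h' \<in> hspan ys n" using Cons x y by simp
  ultimately show ?case unfolding p using F_add[OF x(2) y(2)] by (intro hspan_ConsI)
qed (simp add: F_add)

lemma hspan_neg:
  assumes "fst ` set ys \<subseteq> carrier A" "x \<in> hspan ys n"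
  shows "\<ominus> x \<in> hspan ys n"
  using assms
proof (induction ys arbitrary: x)
  case (Cons p ys)
  obtain z d where p: "p = (z, d)" by (cases p)
  from Cons.prems p obtain u h where
    x: "x = u \<otimes> z \<oplus> h" "u \<in> F (n - d)" "h \<in> hspan ys n" by auto
  have c: "u \<in> carrier A" "z \<in> carrier A" "h \<in> carrier A"
    using x F_carrier hspan_carrier Cons.prems p by auto
  have "\<ominus> x = (\<ominus> u) \<otimes> z \<oplus> (\<ominus> h)" unfolding x(1) using c by algebra
  moreover have "\<ominus> h \<in> hspan ys n" using Cons x by simp
  ultimately show ?case unfolding p using F_neg[OF x(2)] by (intro hspan_ConsI)
qed (simp add: F_neg)

lemma hspan_subgroup:
  assumes "fst ` set ys \<subseteq> carrier A"
  shows "additive_subgroup (hspan ys n) A"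
proof (rule additive_subgroupI, rule add.subgroupI)
  show "hspan ys n \<noteq> {}" using hspan_base[OF assms F_zero] by blast
qed (use assms hspan_carrier hspan_add in \<open>auto simp: a_inv_def[symmetric] hspan_neg\<close>)

lemma hspan_mult_left:
  assumes "fst ` set ys \<subseteq> carrier A" "a \<in> F m" "x \<in> hspan ys n"
  shows "a \<otimes> x \<in> hspan ys (m + n)"
  using assms
proof (induction ys arbitrary: x)
  case Nil
  then show ?case using F_mult[of a m x "n - 1"] by (simp add: algebra_simps)
next
  case (Cons p ys)
  obtain z d where p: "p = (z, d)" by (cases p)
  from Cons.prems p obtain u h where
    x: "x = u \<otimes> z \<oplus> h" "u \<in> F (n - d)" "h \<in> hspan ys n" by auto
  have c: "u \<in> carrier A" "z \<in> carrier A" "h \<in> carrier A" "a \<in> carrier A"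
    using x F_carrier hspan_carrier Cons.prems p by auto
  have "a \<otimes> x = (a \<otimes> u) \<otimes> z \<oplus> (a \<otimes> h)"
    unfolding x(1) using c by algebra
  moreover have "a \<otimes> h \<in> hspan ys (m + n)" using Cons x by simp
  moreover have "a \<otimes> u \<in> F (m + n - d)"
    using F_mult[OF Cons.prems(2) x(2)] by (simp add: algebra_simps)
  ultimately show ?case unfolding p by (intro hspan_ConsI)
qed

lemma hspan_member:
  assumes "fst ` set ys \<subseteq> carrier A" "(y, d) \<in> set ys" "u \<in> F (n - d)"
  shows "u \<otimes> y \<in> hspan ys n"
  using assms
proof (induction ys)
  case (Cons p ys)
  obtain z c where p: "p = (z, c)" by (cases p)
  have car: "u \<in> carrier A" "y \<in> carrier A" using Cons.prems F_carrier by (force, force)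
  show ?case
  proof (cases "(y, d) = p")
    case True
    have "u \<otimes> y = u \<otimes> z \<oplus> \<zero>" using True p car by simp
    moreover have "\<zero> \<in> hspan ys n" using hspan_base F_zero Cons.prems by simp
    ultimately show ?thesis unfolding p using Cons.prems True p by (intro hspan_ConsI) auto
  next
    case False
    then have "u \<otimes> y \<in> hspan ys n" using Cons by simp
    moreover have "u \<otimes> y = \<zero> \<otimes> z \<oplus> u \<otimes> y" using car Cons.prems p by simp
    ultimately show ?thesis unfolding p using F_zero by (intro hspan_ConsI)
  qed
qed simp

lemma hspan_subset:
  assumes "\<And>y d. (y, d) \<in> set ys \<Longrightarrow> y \<in> F d" "x \<in> hspan ys n"
  shows "x \<in> F n"
  using assms
proof (induction ys arbitrary: x)
  case Nil
  then show ?case using F_mono[of "n - 1" n] by simp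
next
  case (Cons p ys)
  obtain z d where p: "p = (z, d)" by (cases p)
  from Cons.prems p obtain u h where
    x: "x = u \<otimes> z \<oplus> h" "u \<in> F (n - d)" "h \<in> hspan ys n" by auto
  have "h \<in> F n" using Cons x by simp
  moreover have "u \<otimes> z \<in> F n" using F_mult[OF x(2), of z d] Cons.prems p by simp
  ultimately show ?case using F_add x by simp
qed

text \<open>\<open>bounded_syz e ys\<close>: the degrees in \<open>ys\<close> lie between \<open>1\<close> and \<open>e\<close>, and for each entry \<open>(y, d)\<close> the
  elements \<open>x\<close> that multiply \<open>y\<close> into the span of the later entries lie in the span of a finite list \<open>zs\<close>
  of such elements. The bound \<open>e\<close> also covers the degree \<open>c + d\<close> of every product \<open>z y\<close> with \<open>(z, c)\<close> in \<open>zs\<close>.\<close>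

fun bounded_syz :: "int \<Rightarrow> ('a \<times> int) list \<Rightarrow> bool" where
  "bounded_syz e [] \<longleftrightarrow> True"
| "bounded_syz e ((y, d) # ys) \<longleftrightarrow> bounded_syz e ys \<and> y \<in> F d \<and> 1 \<le> d \<and> d \<le> e \<and>
     (\<exists>zs. (\<forall>(z, c) \<in> set zs. z \<in> F c \<and> 0 \<le> c \<and> c + d \<le> e \<and> z \<otimes> y \<in> hspan ys (c + d)) \<and>
       (\<forall>n. \<forall>x \<in> F n. x \<otimes> y \<in> hspan ys (n + d) \<longrightarrow> x \<in> hspan zs n))"

lemma bounded_syz_mono: "bounded_syz e ys \<Longrightarrow> e \<le> e' \<Longrightarrow> bounded_syz e' ys"
proof (induction ys)
  case (Cons p ys)
  obtain z d where p: "p = (z, d)" by (cases p)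
  from Cons.prems p obtain zs where ys: "bounded_syz e ys" "z \<in> F d" "1 \<le> d" "d \<le> e"
    and zs: "\<forall>(x, c) \<in> set zs. x \<in> F c \<and> 0 \<le> c \<and> c + d \<le> e \<and> x \<otimes> z \<in> hspan ys (c + d)"
      "\<forall>n. \<forall>x\<in>F n. x \<otimes> z \<in> hspan ys (n + d) \<longrightarrow> x \<in> hspan zs n" by auto
  have "\<forall>(x, c) \<in> set zs. x \<in> F c \<and> 0 \<le> c \<and> c + d \<le> e' \<and> x \<otimes> z \<in> hspan ys (c + d)"
    using zs(1) Cons.prems(2) by (auto dest: order.trans)
  moreover have "bounded_syz e' ys" "d \<le> e'" using Cons ys by auto
  ultimately show ?case unfolding p bounded_syz.simps using ys zs(2) by (metis (no_types, lifting))
qed simp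

lemma bounded_syzD: "bounded_syz e ys \<Longrightarrow> (y, d) \<in> set ys \<Longrightarrow> y \<in> F d \<and> 1 \<le> d \<and> d \<le> e"
  by (induction ys) auto

text \<open>The assumption \<open>noeth\<close> is the left Noetherian property of the associated graded ring, stated for
  the families \<open>M\<close> that are the preimages of homogeneous left ideals.\<close>

lemma bounded_syz_exists:
  assumes noeth: "\<And>M. \<lbrakk>\<And>n. additive_subgroup (M n) A; \<And>n. F (n - 1) \<subseteq> M n; \<And>n. M n \<subseteq> F n;
        \<And>a x m n. a \<in> F m \<Longrightarrow> x \<in> M n \<Longrightarrow> a \<otimes> x \<in> M (m + n)\<rbrakk>
      \<Longrightarrow> \<exists>zs. (\<forall>(z, c) \<in> set zs. z \<in> M c \<and> 0 \<le> c \<and> z \<notin> F (c - 1)) \<and> (\<forall>n. M n \<subseteq> hspan zs n)"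
    and ys: "\<And>y d. (y, d) \<in> set ys \<Longrightarrow> y \<in> F d \<and> 1 \<le> d"
  shows "\<exists>e. bounded_syz e ys"
  using ys
proof (induction ys)
  case (Cons p ys)
  obtain y d where p: "p = (y, d)" by (cases p)
  obtain e where e: "bounded_syz e ys" using Cons by auto
  have y: "y \<in> F d" "1 \<le> d" using Cons.prems p by auto
  then have yc: "y \<in> carrier A" using F_carrier by blast
  have ysc: "fst ` set ys \<subseteq> carrier A" using Cons.prems F_carrier by force
  \<comment> \<open>The colon ideal of the tail by \<open>y\<close>, degree by degree.\<close>
  define M where "M n = {x \<in> F n. x \<otimes> y \<in> hspan ys (n + d)}" for n
  have M1: "F (n - 1) \<subseteq> M n" for n
  proof
    fix x assume x: "x \<in> F (n - 1)"
    have "x \<otimes> y \<in> F ((n + d) - 1)" using F_mult[OF x y(1)] by (simp add: algebra_simps)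
    then show "x \<in> M n" unfolding M_def using F_mono[OF _ x, of n] hspan_base[OF ysc] by simp
  qed
  have M2: "a \<otimes> x \<in> M (m + n)" if "a \<in> F m" "x \<in> M n" for a x m n
  proof -
    have "a \<otimes> x \<otimes> y = a \<otimes> (x \<otimes> y)" using that F_carrier yc by (auto simp: M_def m_assoc)
    moreover have "a \<otimes> (x \<otimes> y) \<in> hspan ys (m + (n + d))"
      using hspan_mult_left[OF ysc that(1)] that(2) by (simp add: M_def)
    ultimately show ?thesis using F_mult that by (simp add: M_def ac_simps)
  qed
  have neg: "\<ominus> x \<in> M n" if "x \<in> M n" for x n
  proof -
    have xc: "x \<in> carrier A" using that F_carrier by (auto simp: M_def)
    have "\<ominus> x \<otimes> y \<in> hspan ys (n + d)" if "x \<otimes> y \<in> hspan ys (n + d)"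
    proof -
      have "\<ominus> x \<otimes> y = \<ominus> (x \<otimes> y)" using xc yc by algebra
      then show ?thesis using hspan_neg[OF ysc that] by simp
    qed
    then show ?thesis using that F_neg by (simp add: M_def)
  qed
  have M3: "additive_subgroup (M n) A" for n
  proof (rule additive_subgroupI, rule add.subgroupI)
    show "M n \<subseteq> carrier A" unfolding M_def using F_carrier by auto
    show "M n \<noteq> {}" using M1[of n] F_zero by blast
    fix x x' assume x: "x \<in> M n" "x' \<in> M n"
    then have "x \<in> carrier A" "x' \<in> carrier A" unfolding M_def using F_carrier by auto
    then show "x \<oplus> x' \<in> M n" using x hspan_add[OF ysc] F_add yc by (simp add: M_def l_distr)
  qed (use neg in \<open>simp add: a_inv_def\<close>)
  have M4: "M n \<subseteq> F n" for n unfolding M_def by auto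
  obtain zs where zs: "\<forall>(z, c) \<in> set zs. z \<in> M c \<and> 0 \<le> c \<and> z \<notin> F (c - 1)" "\<forall>n. M n \<subseteq> hspan zs n"
    using noeth[of M, OF M3 M1 M4 M2] by blast
  define e' where "e' = Max (insert e (insert d ((\<lambda>(z, c). c + d) ` set zs)))"
  have fin: "finite (insert e (insert d ((\<lambda>(z, c). c + d) ` set zs)))" by simp
  have "e \<le> e'" "d \<le> e'" unfolding e'_def by (rule Max_ge[OF fin]; simp)+
  moreover have e'zs: "c + d \<le> e'" if "(z, c) \<in> set zs" for z c
    unfolding e'_def using that by (intro Max_ge[OF fin]) force
  moreover have "bounded_syz e' ys" using bounded_syz_mono[OF e] calculation by simp
  moreover have "\<forall>(z, c) \<in> set zs. z \<in> F c \<and> 0 \<le> c \<and> c + d \<le> e' \<and> z \<otimes> y \<in> hspan ys (c + d)"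
    using zs(1) e'zs by (auto simp: M_def)
  moreover have "\<forall>n. \<forall>x\<in>F n. x \<otimes> y \<in> hspan ys (n + d) \<longrightarrow> x \<in> hspan zs n"
    using zs(2) by (auto simp: M_def)
  ultimately have "bounded_syz e' (p # ys)"
    unfolding p bounded_syz.simps using y by (metis (no_types, lifting))
  then show ?case by blast
qed simp

end

section \<open>The kernel of a truncated presentation\<close>

text \<open>A homomorphism \<open>\<phi>\<close> from \<open>P\<close> to the filtered ring \<open>A\<close>, and an ideal \<open>J\<close> inside its kernel. The group \<open>L\<close> of
  linear forms, constants included, generates \<open>P\<close> and maps onto \<open>F e\<close>; the ideal \<open>J\<close> contains every
  quadratic-linear relation \<open>p q - r\<close> between linear forms. Freeness of \<open>P\<close> is not needed.\<close>

locale truncated_presentation = A: int_filtration A F + ring_hom_ring P A \<phi>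
  for A (structure) and F and P (structure) and \<phi> +
  fixes e :: int and L J :: "'c set" and ys
  assumes F_negative: "n < 0 \<Longrightarrow> F n = {\<zero>}"
    and e_nonneg: "0 \<le> e"
    and ideal_J: "ideal J P"
    and J_kernel: "p \<in> J \<Longrightarrow> \<phi> p = \<zero>"
    and L_subgroup: "additive_subgroup L P"
    and one_L: "\<one>\<^bsub>P\<^esub> \<in> L"
    and L_image: "\<phi> ` L = F e"
    and L_generates: "\<lbrakk>L \<subseteq> X; \<And>p q. \<lbrakk>p \<in> X; q \<in> X\<rbrakk> \<Longrightarrow> p \<oplus>\<^bsub>P\<^esub> q \<in> X;
        \<And>p q. \<lbrakk>p \<in> X; q \<in> X\<rbrakk> \<Longrightarrow> p \<otimes>\<^bsub>P\<^esub> q \<in> X\<rbrakk> \<Longrightarrow> carrier P \<subseteq> X"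
    and relations: "\<lbrakk>p \<in> L; q \<in> L; r \<in> L; \<phi> p \<otimes> \<phi> q = \<phi> r\<rbrakk> \<Longrightarrow> p \<otimes>\<^bsub>P\<^esub> q \<ominus>\<^bsub>P\<^esub> r \<in> J"
    and syz: "A.bounded_syz e ys"
    and generators: "1 \<le> n \<Longrightarrow> F n \<subseteq> A.hspan ys n"
begin

lemma J_carrier: "p \<in> J \<Longrightarrow> p \<in> carrier P"
  by (rule ideal.Icarr[OF ideal_J])

lemma L_carrier: "p \<in> L \<Longrightarrow> p \<in> carrier P"
  by (rule additive_subgroup.a_Hcarr[OF L_subgroup])

lemma J_add: "\<lbrakk>p \<in> J; q \<in> J\<rbrakk> \<Longrightarrow> p \<oplus>\<^bsub>P\<^esub> q \<in> J"
  by (rule additive_subgroup.a_closed[OF ideal.axioms(1)[OF ideal_J]])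

lemma J_neg: "p \<in> J \<Longrightarrow> \<ominus>\<^bsub>P\<^esub> p \<in> J"
  by (rule additive_subgroup.a_inv_closed[OF ideal.axioms(1)[OF ideal_J]])

lemma J_mult_left: "\<lbrakk>p \<in> J; q \<in> carrier P\<rbrakk> \<Longrightarrow> q \<otimes>\<^bsub>P\<^esub> p \<in> J"
  by (rule ideal.I_l_closed[OF ideal_J])

lemma J_mult_right: "\<lbrakk>p \<in> J; q \<in> carrier P\<rbrakk> \<Longrightarrow> p \<otimes>\<^bsub>P\<^esub> q \<in> J"
  by (rule ideal.I_r_closed[OF ideal_J])

lemma L_congruent:
  assumes "p \<in> L" "r \<in> L" "\<phi> p = \<phi> r"
  shows "p \<ominus>\<^bsub>P\<^esub> r \<in> J"
  using relations[OF assms(1) one_L assms(2)] assms L_carrier[OF assms(1)] L_carrier[OF assms(2)] by simp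

text \<open>\<open>weight n p\<close>: modulo \<open>J\<close>, the element \<open>p\<close> is a sum of products of linear forms of total degree at most \<open>n\<close>. The
  degree of a linear form is read off from its value, and is at most \<open>e\<close>. Only elements of \<open>J\<close> have
  negative weight.\<close>

inductive weight :: "int \<Rightarrow> 'c \<Rightarrow> bool" where
  J: "p \<in> J \<Longrightarrow> weight n p"
| L: "\<lbrakk>p \<in> L; \<phi> p \<in> F n; 0 \<le> n; n \<le> e\<rbrakk> \<Longrightarrow> weight n p"
| add: "\<lbrakk>weight n p; weight n q\<rbrakk> \<Longrightarrow> weight n (p \<oplus>\<^bsub>P\<^esub> q)"
| mult: "\<lbrakk>weight m p; weight n q\<rbrakk> \<Longrightarrow> weight (m + n) (p \<otimes>\<^bsub>P\<^esub> q)"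
| step: "weight n p \<Longrightarrow> weight (n + 1) p"

text \<open>The weight filtration of \<open>P\<close>, as a family of sets.\<close>

definition G :: "int \<Rightarrow> 'c set" where "G n = {p. weight n p}"

lemma weight_carrier: "weight n p \<Longrightarrow> p \<in> carrier P"
  by (induction rule: weight.induct) (auto intro: J_carrier L_carrier)

lemma weight_neg: "weight n p \<Longrightarrow> weight n (\<ominus>\<^bsub>P\<^esub> p)"
proof (induction rule: weight.induct)
  case (J p n) then show ?case using J_neg weight.J by blast
next
  case (L p n)
  have "\<phi> (\<ominus>\<^bsub>P\<^esub> p) \<in> F n" using L A.F_neg L_carrier by simp
  with L show ?case using additive_subgroup.a_inv_closed[OF L_subgroup] weight.L by blast
next
  case (add n p q)
  then show ?case using weight.add weight_carrier R.minus_add by simp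
next
  case (mult m p n q)
  then have "weight (m + n) ((\<ominus>\<^bsub>P\<^esub> p) \<otimes>\<^bsub>P\<^esub> q)" using weight.mult by blast
  then show ?case using mult weight_carrier R.l_minus by metis
next
  case (step n p) then show ?case using weight.step by blast
qed

lemma weight_F: "weight n p \<Longrightarrow> \<phi> p \<in> F n"
proof (induction rule: weight.induct)
  case (J p n) then show ?case using J_kernel A.F_zero by simp
next
  case (add n p q) then show ?case using weight_carrier A.F_add by simp
next
  case (mult m p n q) then show ?case using weight_carrier A.F_mult by simp
next
  case (step n p) then show ?case using A.F_step by blast
qed simp

lemma weight_negative: "weight n p \<Longrightarrow> n < 0 \<Longrightarrow> p \<in> J"
proof (induction rule: weight.induct)
  case (add n p q) then show ?case using J_add by simp
next
  case (mult m p n q)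
  then show ?case using J_mult_left J_mult_right weight_carrier by (cases "m < 0") auto
qed auto

sublocale G: int_filtration P G
proof (intro int_filtration.intro int_filtration_axioms.intro)
  show "ring P" by (rule R.ring_axioms)
  show "additive_subgroup (G n) P" for n
  proof (rule additive_subgroupI, rule R.add.subgroupI)
    have "\<zero>\<^bsub>P\<^esub> \<in> J" by (rule additive_subgroup.zero_closed[OF ideal.axioms(1)[OF ideal_J]])
    then show "G n \<noteq> {}" using weight.J by (auto simp: G_def)
  qed (auto simp: G_def a_inv_def[symmetric] intro: weight_carrier weight_neg weight.add)
qed (auto simp: G_def intro: weight.step weight.mult)

lemma J_G: "J \<subseteq> G n"
  by (auto simp: G_def intro: weight.J)

lemma G_image: "p \<in> G n \<Longrightarrow> \<phi> p \<in> F n"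
  using weight_F by (simp add: G_def)

text \<open>Below \<open>e\<close> the relations in \<open>J\<close> reduce every product to a linear form.\<close>

lemma low_representative: "weight n p \<Longrightarrow> n \<le> e \<Longrightarrow> \<exists>q \<in> L. p \<ominus>\<^bsub>P\<^esub> q \<in> J"
proof (induction rule: weight.induct)
  case (J p n)
  have "\<zero>\<^bsub>P\<^esub> \<in> L" by (rule additive_subgroup.zero_closed[OF L_subgroup])
  moreover have "p \<ominus>\<^bsub>P\<^esub> \<zero>\<^bsub>P\<^esub> \<in> J" using J J_carrier by (simp add: a_minus_def)
  ultimately show ?case by blast
next
  case (L p n)
  then show ?case using L_congruent by blast
next
  case (add n p q)
  then obtain p' q' where p': "p' \<in> L" "p \<ominus>\<^bsub>P\<^esub> p' \<in> J" and q': "q' \<in> L" "q \<ominus>\<^bsub>P\<^esub> q' \<in> J" by auto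
  have c: "p \<in> carrier P" "q \<in> carrier P" "p' \<in> carrier P" "q' \<in> carrier P"
    using add p' q' weight_carrier L_carrier by auto
  have "(p \<oplus>\<^bsub>P\<^esub> q) \<ominus>\<^bsub>P\<^esub> (p' \<oplus>\<^bsub>P\<^esub> q') = (p \<ominus>\<^bsub>P\<^esub> p') \<oplus>\<^bsub>P\<^esub> (q \<ominus>\<^bsub>P\<^esub> q')"
    using c by algebra
  then have "(p \<oplus>\<^bsub>P\<^esub> q) \<ominus>\<^bsub>P\<^esub> (p' \<oplus>\<^bsub>P\<^esub> q') \<in> J" using J_add p' q' by simp
  moreover have "p' \<oplus>\<^bsub>P\<^esub> q' \<in> L" using additive_subgroup.a_closed[OF L_subgroup] p' q' by blast
  ultimately show ?case by blast
next
  case (mult m p n q)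
  show ?case
  proof (cases "m < 0 \<or> n < 0")
    case True
    then have "p \<otimes>\<^bsub>P\<^esub> q \<in> J"
      using mult weight_negative weight_carrier J_mult_left J_mult_right by blast
    moreover have "\<zero>\<^bsub>P\<^esub> \<in> L" by (rule additive_subgroup.zero_closed[OF L_subgroup])
    moreover have "p \<otimes>\<^bsub>P\<^esub> q \<ominus>\<^bsub>P\<^esub> \<zero>\<^bsub>P\<^esub> = p \<otimes>\<^bsub>P\<^esub> q"
      using mult weight_carrier by (simp add: a_minus_def)
    ultimately show ?thesis by metis
  next
    case False
    then obtain p' q' where p': "p' \<in> L" "p \<ominus>\<^bsub>P\<^esub> p' \<in> J" and q': "q' \<in> L" "q \<ominus>\<^bsub>P\<^esub> q' \<in> J"
      using mult by auto
    have c: "p \<in> carrier P" "q \<in> carrier P" "p' \<in> carrier P" "q' \<in> carrier P"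
      using mult p' q' weight_carrier L_carrier by auto
    have eq: "\<phi> x = \<phi> y" if "x \<ominus>\<^bsub>P\<^esub> y \<in> J" "x \<in> carrier P" "y \<in> carrier P" for x y
    proof -
      have "x = (x \<ominus>\<^bsub>P\<^esub> y) \<oplus>\<^bsub>P\<^esub> y" using that by algebra
      then have "\<phi> x = \<phi> (x \<ominus>\<^bsub>P\<^esub> y) \<oplus> \<phi> y" using that R.minus_closed hom_add by metis
      then show ?thesis using J_kernel[OF that(1)] that by simp
    qed
    have "\<phi> (p \<otimes>\<^bsub>P\<^esub> q) \<in> F e"
      using A.F_mono[OF mult.prems weight_F[OF weight.mult[OF mult.hyps]]] .
    then obtain r where r: "r \<in> L" "\<phi> r = \<phi> (p \<otimes>\<^bsub>P\<^esub> q)" using L_image by (metis imageE)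
    then have rc: "r \<in> carrier P" using L_carrier by blast
    \<comment> \<open>The product of two linear forms with value in \<open>F e\<close> is congruent to the linear form \<open>r\<close>.\<close>
    have "p' \<otimes>\<^bsub>P\<^esub> q' \<ominus>\<^bsub>P\<^esub> r \<in> J"
      using relations[OF p'(1) q'(1) r(1)] eq[OF p'(2)] eq[OF q'(2)] r(2) c by simp
    moreover have "(p \<ominus>\<^bsub>P\<^esub> p') \<otimes>\<^bsub>P\<^esub> q \<in> J" "p' \<otimes>\<^bsub>P\<^esub> (q \<ominus>\<^bsub>P\<^esub> q') \<in> J"
      using J_mult_left J_mult_right p' q' c by auto
    ultimately have "(p \<ominus>\<^bsub>P\<^esub> p') \<otimes>\<^bsub>P\<^esub> q \<oplus>\<^bsub>P\<^esub> p' \<otimes>\<^bsub>P\<^esub> (q \<ominus>\<^bsub>P\<^esub> q') \<oplus>\<^bsub>P\<^esub> (p' \<otimes>\<^bsub>P\<^esub> q' \<ominus>\<^bsub>P\<^esub> r) \<in> J"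
      using J_add by blast
    moreover have "(p \<ominus>\<^bsub>P\<^esub> p') \<otimes>\<^bsub>P\<^esub> q \<oplus>\<^bsub>P\<^esub> p' \<otimes>\<^bsub>P\<^esub> (q \<ominus>\<^bsub>P\<^esub> q') \<oplus>\<^bsub>P\<^esub> (p' \<otimes>\<^bsub>P\<^esub> q' \<ominus>\<^bsub>P\<^esub> r) = p \<otimes>\<^bsub>P\<^esub> q \<ominus>\<^bsub>P\<^esub> r"
      using c rc by algebra
    ultimately show ?thesis using r(1) by auto
  qed
qed auto

lemma low_kernel:
  assumes "p \<in> G n" "n \<le> e" "\<phi> p = \<zero>"
  shows "p \<in> J"
proof -
  obtain q where q: "q \<in> L" "p \<ominus>\<^bsub>P\<^esub> q \<in> J"
    using low_representative assms by (auto simp: G_def)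
  have c: "p \<in> carrier P" "q \<in> carrier P" using assms weight_carrier L_carrier q by (auto simp: G_def)
  have "\<phi> q = \<zero>" using J_kernel[OF q(2)] assms(3) c by (simp add: a_minus_def)
  moreover have z: "\<zero>\<^bsub>P\<^esub> \<in> L" by (rule additive_subgroup.zero_closed[OF L_subgroup])
  ultimately have "q \<ominus>\<^bsub>P\<^esub> \<zero>\<^bsub>P\<^esub> \<in> J" using L_congruent[OF q(1) z] by simp
  then have "q \<in> J" using c by (simp add: a_minus_def)
  then have "(p \<ominus>\<^bsub>P\<^esub> q) \<oplus>\<^bsub>P\<^esub> q \<in> J" using J_add q by blast
  moreover have "(p \<ominus>\<^bsub>P\<^esub> q) \<oplus>\<^bsub>P\<^esub> q = p" using c by algebra
  ultimately show ?thesis by simp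
qed

lemma low_image:
  assumes "n \<le> e" "x \<in> F n"
  shows "\<exists>p \<in> G n. \<phi> p = x"
proof (cases "n < 0")
  case True
  then have "x = \<zero>" using F_negative assms by simp
  then show ?thesis using G.F_zero by (intro bexI[of _ "\<zero>\<^bsub>P\<^esub>"]) auto
next
  case False
  then obtain p where "p \<in> L" "\<phi> p = x" using A.F_mono[OF assms] L_image by (metis imageE)
  then show ?thesis using False assms weight.L[of p n] by (intro bexI[of _ p]) (auto simp: G_def)
qed

text \<open>A chosen preimage of weight \<open>n\<close>; it exists for \<open>x \<in> F n\<close> and \<open>n \<le> e\<close>.\<close>

definition lift :: "int \<Rightarrow> 'a \<Rightarrow> 'c" where "lift n x = (SOME p. p \<in> G n \<and> \<phi> p = x)"

abbreviation lifts :: "('a \<times> int) list \<Rightarrow> ('c \<times> int) list" where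
  "lifts \<equiv> map (\<lambda>(y, d). (lift d y, d))"

lemma lift_low:
  assumes "n \<le> e" "x \<in> F n"
  shows "lift n x \<in> G n" "\<phi> (lift n x) = x"
  using someI_ex[of "\<lambda>p. p \<in> G n \<and> \<phi> p = x"] low_image[OF assms] unfolding lift_def by auto

lemma lift_hspan:
  assumes "\<And>y d. (y, d) \<in> set zs \<Longrightarrow> y \<in> F d \<and> d \<le> e"
    and "\<And>m z. m \<in> insert (n - 1) ((\<lambda>(y, d). n - d) ` set zs) \<Longrightarrow> z \<in> F m \<Longrightarrow> \<exists>p \<in> G m. \<phi> p = z"
    and "x \<in> A.hspan zs n"
  shows "\<exists>p \<in> G.hspan (lifts zs) n. \<phi> p = x"
  using assms
proof (induction zs arbitrary: x)
  case (Cons q zs)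
  obtain y d where q: "q = (y, d)" by (cases q)
  from Cons.prems q obtain u h where x: "x = u \<otimes> y \<oplus> h" "u \<in> F (n - d)" "h \<in> A.hspan zs n" by auto
  have "y \<in> F d" "d \<le> e" using Cons.prems(1) q by auto
  then have y: "lift d y \<in> G d" "\<phi> (lift d y) = y" using lift_low by blast+
  obtain h' where h': "h' \<in> G.hspan (lifts zs) n" "\<phi> h' = h"
    using Cons.IH[OF _ _ x(3)] Cons.prems(1,2) by (metis (no_types, lifting) image_insert insertCI insertE list.simps(15))
  obtain u' where u': "u' \<in> G (n - d)" "\<phi> u' = u" using Cons.prems(2)[of "n - d" u] x(2) q by auto
  have "fst ` set (lifts zs) \<subseteq> carrier P"
    using lift_low Cons.prems(1) G.F_carrier by (force)
  then have "h' \<in> carrier P" using h' G.hspan_carrier by blast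
  then have "\<phi> (u' \<otimes>\<^bsub>P\<^esub> lift d y \<oplus>\<^bsub>P\<^esub> h') = x" using x y u' h' G.F_carrier by simp
  moreover have "u' \<otimes>\<^bsub>P\<^esub> lift d y \<oplus>\<^bsub>P\<^esub> h' \<in> G.hspan (lifts (q # zs)) n" using q u' h' by auto
  ultimately show ?case by blast
qed simp

lemma lifts_carrier:
  assumes "\<And>y d. (y, d) \<in> set zs \<Longrightarrow> y \<in> F d \<and> d \<le> e"
  shows "fst ` set (lifts zs) \<subseteq> carrier P"
  using lift_low assms G.F_carrier by force

text \<open>Surjectivity in every weight: above \<open>e\<close> the generators \<open>ys\<close> lower the degree strictly.\<close>

lemma weight_image:
  assumes "x \<in> F n"
  shows "\<exists>p \<in> G n. \<phi> p = x"
proof -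
  have "\<forall>n x. n \<le> e + int k \<longrightarrow> x \<in> F n \<longrightarrow> (\<exists>p \<in> G n. \<phi> p = x)" for k
  proof (induction k)
    case 0 then show ?case using low_image by simp
  next
    case (Suc k)
    show ?case
    proof (intro allI impI)
      fix n x assume n: "n \<le> e + int (Suc k)" "x \<in> F n"
      show "\<exists>p \<in> G n. \<phi> p = x"
      proof (cases "n \<le> e")
        case False
        then have "x \<in> A.hspan ys n" using generators[of n] n e_nonneg by auto
        then obtain p where p: "p \<in> G.hspan (lifts ys) n" "\<phi> p = x"
          using lift_hspan[of ys n x] A.bounded_syzD[OF syz] Suc n by fastforce
        have "p \<in> G n" using p(1) lift_low A.bounded_syzD[OF syz]
          by (intro G.hspan_subset[OF _ p(1)]) auto
        then show ?thesis using p by blast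
      qed (use low_image n in simp)
    qed
  qed
  from this[of "nat (n - e)"] show ?thesis using assms by simp
qed

lemma hspan_lifts_J:
  assumes "\<And>y d. (y, d) \<in> set zs \<Longrightarrow> y \<in> F d \<and> d \<le> e" "p \<in> carrier P" 
    and "q \<in> G.hspan (lifts zs) n" "p \<ominus>\<^bsub>P\<^esub> q \<in> J"
  shows "p \<in> G.hspan (lifts zs) n"
proof -
  have c: "fst ` set (lifts zs) \<subseteq> carrier P" using lifts_carrier assms(1) by blast
  have "p \<ominus>\<^bsub>P\<^esub> q \<in> G.hspan (lifts zs) n" using G.hspan_base[OF c] J_G assms(4) by blast
  then have "(p \<ominus>\<^bsub>P\<^esub> q) \<oplus>\<^bsub>P\<^esub> q \<in> G.hspan (lifts zs) n" using G.hspan_add[OF c] assms(3) by blast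
  moreover have "(p \<ominus>\<^bsub>P\<^esub> q) \<oplus>\<^bsub>P\<^esub> q = p"
    using assms(2) G.hspan_carrier[OF c assms(3)] by algebra
  ultimately show ?thesis by simp
qed

text \<open>Up to degree \<open>e\<close>, membership in a span can be tested on values, because the kernel lies in \<open>J\<close>
  there.\<close>

lemma hspan_low:
  assumes zs: "\<And>y d. (y, d) \<in> set zs \<Longrightarrow> y \<in> F d \<and> d \<le> e"
    and p: "p \<in> G n" "n \<le> e" "\<phi> p \<in> A.hspan zs n"
  shows "p \<in> G.hspan (lifts zs) n"
proof -
  obtain q where q: "q \<in> G.hspan (lifts zs) n" "\<phi> q = \<phi> p"
    using lift_hspan[OF zs weight_image p(3)] by blast
  have "q \<in> G n" by (rule G.hspan_subset[OF _ q(1)]) (use zs lift_low in auto)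
  then have "p \<ominus>\<^bsub>P\<^esub> q \<in> G n" using p(1) G.F_minus by blast
  moreover have "\<phi> (p \<ominus>\<^bsub>P\<^esub> q) = \<zero>"
    using q \<open>q \<in> G n\<close> p(1) G.F_carrier[OF p(1)] G.F_carrier[of q n] by (simp add: a_minus_def A.r_neg)
  ultimately have "p \<ominus>\<^bsub>P\<^esub> q \<in> J" using low_kernel p(2) by blast
  then show ?thesis using hspan_lifts_J[OF zs _ q(1)] G.F_carrier[OF p(1)] by blast
qed

lemma ys_bounds: "(y, d) \<in> set ys \<Longrightarrow> y \<in> F d \<and> d \<le> e"
  using A.bounded_syzD[OF syz] by blast

text \<open>The filtration \<open>G\<close> of \<open>P\<close> is generated by the lifts of \<open>ys\<close>, just as \<open>F\<close> is generated by \<open>ys\<close>. If the second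
  factor \<open>q\<close> of a product has weight \<open>0\<close>, the first factor is decomposed instead: for a lift \<open>Y\<close> of degree
  \<open>d\<close> the product \<open>Y q\<close> has weight \<open>d \<le> e\<close>, so it is again in the span of the lifts.\<close>

lemma decomposition: "weight n p \<Longrightarrow> 1 \<le> n \<Longrightarrow> p \<in> G.hspan (lifts ys) n"
proof (induction rule: weight.induct)
  case (J p n)
  then show ?case using G.hspan_base[OF lifts_carrier[OF ys_bounds]] J_G by blast
next
  case (L p n)
  then have "p \<in> G n" using weight.L by (simp add: G_def)
  moreover have "\<phi> p \<in> A.hspan ys n" using generators L by blast
  ultimately show ?case using hspan_low[OF ys_bounds] L by blast
next
  case (add n p q)
  then show ?case using G.hspan_add[OF lifts_carrier[OF ys_bounds]] by blast
next
  case (step n p)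
  then have "p \<in> G (n + 1 - 1)" by (simp add: G_def)
  then show ?case using G.hspan_base[OF lifts_carrier[OF ys_bounds]] by blast
next
  case (mult m p n q)
  note c = lifts_carrier[OF ys_bounds]
  have pq: "p \<in> G m" "q \<in> G n" using mult by (auto simp: G_def)
  then have pqc: "p \<in> carrier P" "q \<in> carrier P" using G.F_carrier by auto
  consider "1 \<le> n" | "n < 0" | "n = 0" by linarith
  then show ?case
  proof cases
    case 1
    then show ?thesis using mult G.hspan_mult_left[OF c pq(1)] by blast
  next
    case 2
    then have "q \<in> J" using weight_negative mult by blast
    then have "p \<otimes>\<^bsub>P\<^esub> q \<in> J" using J_mult_left pqc by blast
    then show ?thesis using G.hspan_base[OF c] J_G by blast
  next
    case 3
    have "h \<otimes>\<^bsub>P\<^esub> q \<in> G.hspan (lifts ys) m"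
      if "h \<in> G.hspan (lifts zs) m" "set zs \<subseteq> set ys" for h zs
      using that
    proof (induction zs arbitrary: h)
      case Nil
      then show ?case using G.F_mult[of h "m - 1" q n] pq 3 G.hspan_base[OF c] by simp
    next
      case (Cons r zs)
      obtain y d where r: "r = (y, d)" by (cases r)
      from Cons.prems(1) r obtain u g where
        h: "h = u \<otimes>\<^bsub>P\<^esub> lift d y \<oplus>\<^bsub>P\<^esub> g" "u \<in> G (m - d)" "g \<in> G.hspan (lifts zs) m" by auto
      have yd: "y \<in> F d" "1 \<le> d" "d \<le> e" using Cons.prems(2) r A.bounded_syzD[OF syz] by auto
      have Y: "lift d y \<in> G d" using lift_low yd by blast
      have "lift d y \<otimes>\<^bsub>P\<^esub> q \<in> G d" using G.F_mult[OF Y pq(2)] 3 by simp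
      then have "lift d y \<otimes>\<^bsub>P\<^esub> q \<in> G.hspan (lifts ys) d"
        using hspan_low[OF ys_bounds _ yd(3)] generators[OF yd(2)] G_image by blast
      then have "u \<otimes>\<^bsub>P\<^esub> (lift d y \<otimes>\<^bsub>P\<^esub> q) \<in> G.hspan (lifts ys) m"
        using G.hspan_mult_left[OF c h(2)] by fastforce
      moreover have "g \<otimes>\<^bsub>P\<^esub> q \<in> G.hspan (lifts ys) m" using Cons h by simp
      moreover have "g \<in> carrier P"
        using ys_bounds Cons.prems(2) by (intro G.hspan_carrier[OF lifts_carrier h(3)]) auto
      then have "h \<otimes>\<^bsub>P\<^esub> q = u \<otimes>\<^bsub>P\<^esub> (lift d y \<otimes>\<^bsub>P\<^esub> q) \<oplus>\<^bsub>P\<^esub> g \<otimes>\<^bsub>P\<^esub> q"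
        unfolding h(1) using pqc G.F_carrier[OF h(2)] G.F_carrier[OF Y] by algebra
      ultimately show ?case using G.hspan_add[OF c] by simp
    qed
    then show ?thesis using mult 3 by auto
  qed
qed

lemma hspan_lifts_image:
  assumes "\<And>y d. (y, d) \<in> set zs \<Longrightarrow> y \<in> F d \<and> d \<le> e" "p \<in> G.hspan (lifts zs) n"
  shows "\<phi> p \<in> A.hspan zs n"
  using assms
proof (induction zs arbitrary: p)
  case Nil
  then show ?case using G_image by simp
next
  case (Cons s zs)
  obtain z b where s: "s = (z, b)" by (cases s)
  from Cons.prems(2) s obtain v f where
    p: "p = v \<otimes>\<^bsub>P\<^esub> lift b z \<oplus>\<^bsub>P\<^esub> f" "v \<in> G (n - b)" "f \<in> G.hspan (lifts zs) n" by auto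
  have "z \<in> F b" "b \<le> e" using Cons.prems(1) s by auto
  then have Z: "lift b z \<in> G b" "\<phi> (lift b z) = z" using lift_low by blast+
  have "f \<in> carrier P"
    using Cons.prems(1) by (intro G.hspan_carrier[OF lifts_carrier p(3)]) auto
  then have "\<phi> p = \<phi> v \<otimes> z \<oplus> \<phi> f" using p Z G.F_carrier by simp
  moreover have "\<phi> f \<in> A.hspan zs n" using Cons.IH[OF _ p(3)] Cons.prems(1) by auto
  ultimately show ?case unfolding s using G_image[OF p(2)] by (intro A.hspan_ConsI)
qed

text \<open>The kernel of \<open>\<phi>\<close> lies in \<open>J\<close>. The outer induction is on the weight, the inner one (fact \<open>J\<close> below) on
  the list of generators that occur in the decomposition.\<close>

lemma weight_kernel:
  assumes "p \<in> G n" "\<phi> p = \<zero>"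
  shows "p \<in> J"
proof -
  have "\<forall>n p. n \<le> e + int k \<longrightarrow> p \<in> G n \<longrightarrow> \<phi> p = \<zero> \<longrightarrow> p \<in> J" for k
  proof (induction k)
    case 0 then show ?case using low_kernel by simp
  next
    case (Suc k)
    then have IH: "p \<in> J" if "n \<le> e + int k" "p \<in> G n" "\<phi> p = \<zero>" for n p using that by blast
    have J: "h \<in> J" if "A.bounded_syz e zs" "h \<in> G.hspan (lifts zs) n" "\<phi> h = \<zero>" "n \<le> e + int (Suc k)" for zs h n
      using that
    proof (induction zs arbitrary: h)
      case Nil
      then show ?case using IH[of "n - 1" h] by simp
    next
      case (Cons r zs)
      obtain y d where r: "r = (y, d)" by (cases r)
      have zs: "A.bounded_syz e zs" and yd: "y \<in> F d" "1 \<le> d" "d \<le> e" using Cons.prems(1) r by auto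
      from Cons.prems(1) r obtain ts where
        ts: "\<And>z c. (z, c) \<in> set ts \<Longrightarrow> z \<in> F c \<and> 0 \<le> c \<and> c + d \<le> e \<and> z \<otimes> y \<in> A.hspan zs (c + d)"
        and ts': "\<And>n x. x \<in> F n \<Longrightarrow> x \<otimes> y \<in> A.hspan zs (n + d) \<Longrightarrow> x \<in> A.hspan ts n" by fastforce
      have zsb: "y \<in> F d \<and> d \<le> e" if "(y, d) \<in> set zs" for y d
        using A.bounded_syzD[OF zs] that by blast
      have tsb: "y \<in> F d \<and> d \<le> e" if "(y, d) \<in> set ts" for y d
        using ts yd(2) that by fastforce
      note c = lifts_carrier[OF zsb]
      from Cons.prems(2) r obtain u g where
        h: "h = u \<otimes>\<^bsub>P\<^esub> lift d y \<oplus>\<^bsub>P\<^esub> g" "u \<in> G (n - d)" "g \<in> G.hspan (lifts zs) n" by auto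
      have Y: "lift d y \<in> G d" "\<phi> (lift d y) = y" using lift_low yd by auto
      have car: "u \<in> carrier P" "lift d y \<in> carrier P" "g \<in> carrier P"
        using h G.F_carrier Y G.hspan_carrier[OF c] by auto
      have image: "\<phi> g \<in> A.hspan zs n"
        using hspan_lifts_image[OF zsb h(3)] .
      have yc: "y \<in> carrier A" using A.F_carrier yd by blast
      have zsc: "fst ` set zs \<subseteq> carrier A" using zsb A.F_carrier by force
      have "\<phi> u \<otimes> y \<oplus> \<phi> g = \<zero>" using Cons.prems(3) h(1) Y car by simp
      then have "\<phi> u \<otimes> y = \<ominus> \<phi> g" using A.minus_equality[of "\<phi> u \<otimes> y" "\<phi> g"] car yc by simp
      then have "\<phi> u \<otimes> y \<in> A.hspan zs (n - d + d)" using A.hspan_neg[OF zsc image] by simp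
      then have "\<phi> u \<in> A.hspan ts (n - d)" using ts' G_image h(2) by blast
      then obtain w where w: "w \<in> G.hspan (lifts ts) (n - d)" "\<phi> w = \<phi> u"
        using lift_hspan[OF tsb weight_image] by blast
      have wG: "w \<in> G (n - d)" by (rule G.hspan_subset[OF _ w(1)]) (use tsb lift_low in auto)
      have wc: "w \<in> carrier P" using wG G.F_carrier by blast
      \<comment> \<open>As \<open>d \<ge> 1\<close>, the coefficient \<open>u\<close> has smaller weight, and the outer induction applies.\<close>
      have uw: "u \<ominus>\<^bsub>P\<^esub> w \<in> J"
      proof (rule IH[of "n - d"])
        show "n - d \<le> e + int k" using Cons.prems(4) yd by simp
        show "u \<ominus>\<^bsub>P\<^esub> w \<in> G (n - d)" using G.F_minus h(2) wG by blast
        show "\<phi> (u \<ominus>\<^bsub>P\<^esub> w) = \<zero>" using w car wc by (simp add: a_minus_def A.r_neg)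
      qed
      \<comment> \<open>Each syzygy generator times \<open>y\<close> is a relation of weight at most \<open>e\<close>; it eliminates \<open>y\<close>.\<close>
      have "w' \<otimes>\<^bsub>P\<^esub> lift d y \<in> G.hspan (lifts zs) n"
        if "w' \<in> G.hspan (lifts us) (n - d)" "set us \<subseteq> set ts" for w' us
        using that
      proof (induction us arbitrary: w')
        case Nil
        then have "w' \<otimes>\<^bsub>P\<^esub> lift d y \<in> G (n - 1)" using G.F_mult[of w' "n - d - 1" _ d] Y(1) by simp
        then show ?case using G.hspan_base[OF c] by blast
      next
        case (Cons s us)
        obtain z b where s: "s = (z, b)" by (cases s)
        from Cons.prems(1) s obtain v f where
          g: "w' = v \<otimes>\<^bsub>P\<^esub> lift b z \<oplus>\<^bsub>P\<^esub> f" "v \<in> G (n - d - b)" "f \<in> G.hspan (lifts us) (n - d)" by auto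
        have zb: "z \<in> F b" "b + d \<le> e" "z \<otimes> y \<in> A.hspan zs (b + d)" "b \<le> e"
          using ts[of z b] Cons.prems(2) s yd by auto
        have Z: "lift b z \<in> G b" "\<phi> (lift b z) = z" using lift_low zb by auto
        have "lift b z \<otimes>\<^bsub>P\<^esub> lift d y \<in> G.hspan (lifts zs) (b + d)"
          using Z Y zb G.F_carrier by (intro hspan_low[OF zsb] G.F_mult) auto
        then have "v \<otimes>\<^bsub>P\<^esub> (lift b z \<otimes>\<^bsub>P\<^esub> lift d y) \<in> G.hspan (lifts zs) (n - d - b + (b + d))"
          using G.hspan_mult_left[OF c g(2)] by blast
        moreover have "f \<otimes>\<^bsub>P\<^esub> lift d y \<in> G.hspan (lifts zs) n" using Cons g by auto
        moreover have "f \<in> carrier P"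
          using tsb Cons.prems(2) by (intro G.hspan_carrier[OF lifts_carrier g(3)]) auto
        then have "w' \<otimes>\<^bsub>P\<^esub> lift d y = v \<otimes>\<^bsub>P\<^esub> (lift b z \<otimes>\<^bsub>P\<^esub> lift d y) \<oplus>\<^bsub>P\<^esub> f \<otimes>\<^bsub>P\<^esub> lift d y"
          unfolding g(1) using car G.F_carrier[OF g(2)] G.F_carrier[OF Z(1)] by algebra
        ultimately show ?case using G.hspan_add[OF c] by simp
      qed
      then have "w \<otimes>\<^bsub>P\<^esub> lift d y \<in> G.hspan (lifts zs) n" using w by blast
      then have h'G: "w \<otimes>\<^bsub>P\<^esub> lift d y \<oplus>\<^bsub>P\<^esub> g \<in> G.hspan (lifts zs) n" using G.hspan_add[OF c] h(3) by blast
      have J1: "(u \<ominus>\<^bsub>P\<^esub> w) \<otimes>\<^bsub>P\<^esub> lift d y \<in> J" using J_mult_right uw car by blast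
      have heq: "h = (u \<ominus>\<^bsub>P\<^esub> w) \<otimes>\<^bsub>P\<^esub> lift d y \<oplus>\<^bsub>P\<^esub> (w \<otimes>\<^bsub>P\<^esub> lift d y \<oplus>\<^bsub>P\<^esub> g)"
        unfolding h(1) using car wc by algebra
      have "\<phi> (w \<otimes>\<^bsub>P\<^esub> lift d y \<oplus>\<^bsub>P\<^esub> g) = \<zero>"
        using Cons.prems(3) unfolding h(1) using w car wc by simp
      then have "w \<otimes>\<^bsub>P\<^esub> lift d y \<oplus>\<^bsub>P\<^esub> g \<in> J" using Cons.IH zs h'G Cons.prems(4) by blast
      then show ?case using heq J1 J_add by simp
    qed
    show ?case
    proof (intro allI impI)
      fix n p assume p: "n \<le> e + int (Suc k)" "p \<in> G n" "\<phi> p = \<zero>"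
      show "p \<in> J"
      proof (cases "n \<le> e")
        case False
        then show ?thesis using J[OF syz _ p(3,1)] decomposition p(2) e_nonneg by (simp add: G_def)
      qed (use low_kernel p in blast)
    qed
  qed
  moreover have "n \<le> e + int (nat (n - e))" by simp
  ultimately show ?thesis using assms by blast
qed

lemma carrier_eq: "carrier P = (\<Union>n. G n)"
proof (rule equalityI)
  have inL: "p \<in> G e" if p: "p \<in> L" for p
  proof -
    have "\<phi> p \<in> F e" unfolding L_image[symmetric] using p by (rule imageI)
    from weight.L[OF p this e_nonneg order.refl] show ?thesis by (simp only: G_def mem_Collect_eq)
  qed
  show "carrier P \<subseteq> (\<Union>n. G n)"
  proof (rule L_generates)
    show "L \<subseteq> (\<Union>n. G n)" by (rule subsetI, rule UN_I[of e], rule UNIV_I, erule inL)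
  next
    fix p q assume p: "p \<in> (\<Union>n. G n)" and q: "q \<in> (\<Union>n. G n)"
    from p obtain m where m: "p \<in> G m" by (rule UN_E)
    from q obtain n where n: "q \<in> G n" by (rule UN_E)
    have "p \<oplus>\<^bsub>P\<^esub> q \<in> G (max m n)"
      by (rule G.F_add[OF G.F_mono[OF max.cobounded1 m] G.F_mono[OF max.cobounded2 n]])
    then show "p \<oplus>\<^bsub>P\<^esub> q \<in> (\<Union>n. G n)" by (rule UN_I[OF UNIV_I])
    from G.F_mult[OF m n] show "p \<otimes>\<^bsub>P\<^esub> q \<in> (\<Union>n. G n)" by (rule UN_I[OF UNIV_I])
  qed
  show "(\<Union>n. G n) \<subseteq> carrier P" by (rule UN_least, rule subsetI, rule G.F_carrier)
qed

theorem kernel_eq: "a_kernel P A \<phi> = J"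
proof (rule equalityI)
  show "a_kernel P A \<phi> \<subseteq> J"
  proof
    fix p assume p: "p \<in> a_kernel P A \<phi>"
    then have "p \<in> (\<Union>n. G n)" and zero: "\<phi> p = \<zero>"
      unfolding a_kernel_def' carrier_eq by auto
    from this(1) obtain n where "p \<in> G n" by (rule UN_E)
    from this zero show "p \<in> J" by (rule weight_kernel)
  qed
  show "J \<subseteq> a_kernel P A \<phi>"
    unfolding a_kernel_def' by (intro subsetI CollectI conjI J_carrier J_kernel)
qed

theorem image_eq: "\<phi> ` carrier P = (\<Union>n. F n)"
proof
  show "\<phi> ` carrier P \<subseteq> (\<Union>n. F n)" using G_image carrier_eq by auto
  show "(\<Union>n. F n) \<subseteq> \<phi> ` carrier P"
  proof
    fix x assume "x \<in> (\<Union>n. F n)"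
    then obtain n where "x \<in> F n" by blast
    then obtain p where "p \<in> G n" "\<phi> p = x" using weight_image by blast
    then show "x \<in> \<phi> ` carrier P" using G.F_carrier[of p n] by blast
  qed
qed

end

section \<open>The free algebra\<close>

context cring begin

text \<open>Multiplication in the free algebra is convolution of coefficient functions on words. The ring laws
  hold for arbitrary functions with values in the coefficient ring (\<open>coeff_fun\<close>), and are proved by
  recursion on the word (\<open>conv_Cons\<close>); finite support plays no role.\<close>

definition conv :: "('l list \<Rightarrow> 'a) \<Rightarrow> ('l list \<Rightarrow> 'a) \<Rightarrow> 'l list \<Rightarrow> 'a" where
  "conv p q w = (\<Oplus>i \<in> {..length w}. p (take i w) \<otimes> q (drop i w))"

text \<open>All functions from words to the coefficient ring, of any support.\<close>

definition coeff_fun :: "('l list \<Rightarrow> 'a) set" where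
  "coeff_fun = {p. \<forall>w. p w \<in> carrier R}"

lemma conv_Nil: "\<lbrakk>p \<in> coeff_fun; q \<in> coeff_fun\<rbrakk> \<Longrightarrow> conv p q [] = p [] \<otimes> q []"
  by (simp add: conv_def coeff_fun_def)

lemma conv_Cons:
  assumes "p \<in> coeff_fun" "q \<in> coeff_fun"
  shows "conv p q (a # w) = p [] \<otimes> q (a # w) \<oplus> conv (\<lambda>v. p (a # v)) q w"
proof -
  have "conv p q (a # w) = (\<Oplus>i \<in> {..Suc (length w)}. p (take i (a # w)) \<otimes> q (drop i (a # w)))"
    by (simp add: conv_def)
  also have "\<dots> = (\<Oplus>i \<in> {..length w}. p (take (Suc i) (a # w)) \<otimes> q (drop (Suc i) (a # w)))
      \<oplus> p (take 0 (a # w)) \<otimes> q (drop 0 (a # w))"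
    using assms by (intro finsum_Suc2) (auto simp: coeff_fun_def)
  also have "\<dots> = conv (\<lambda>v. p (a # v)) q w \<oplus> p [] \<otimes> q (a # w)"
    by (simp add: conv_def)
  finally show ?thesis
    using assms by (simp add: a_comm conv_def coeff_fun_def)
qed

lemma coeff_fun_shift: "p \<in> coeff_fun \<Longrightarrow> (\<lambda>v. p (a # v)) \<in> coeff_fun"
  by (simp add: coeff_fun_def)

lemma conv_closed: "\<lbrakk>p \<in> coeff_fun; q \<in> coeff_fun\<rbrakk> \<Longrightarrow> conv p q w \<in> carrier R"
  by (auto simp: conv_def coeff_fun_def intro!: finsum_closed)

lemma conv_coeff_fun: "\<lbrakk>p \<in> coeff_fun; q \<in> coeff_fun\<rbrakk> \<Longrightarrow> conv p q \<in> coeff_fun"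
  by (auto simp: coeff_fun_def conv_def intro!: finsum_closed)

lemma coeff_funD: "p \<in> coeff_fun \<Longrightarrow> p w \<in> carrier R"
  by (simp add: coeff_fun_def)

lemma coeff_fun_add: "\<lbrakk>p \<in> coeff_fun; q \<in> coeff_fun\<rbrakk> \<Longrightarrow> (\<lambda>w. p w \<oplus> q w) \<in> coeff_fun"
  by (simp add: coeff_fun_def)

lemma coeff_fun_smult: "\<lbrakk>c \<in> carrier R; p \<in> coeff_fun\<rbrakk> \<Longrightarrow> (\<lambda>w. c \<otimes> p w) \<in> coeff_fun"
  by (simp add: coeff_fun_def)

lemma conv_add_left:
  assumes "p \<in> coeff_fun" "p' \<in> coeff_fun" "q \<in> coeff_fun"
  shows "conv (\<lambda>w. p w \<oplus> p' w) q w = conv p q w \<oplus> conv p' q w"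
  using assms by (simp add: conv_def coeff_fun_def l_distr finsum_addf Pi_def)

lemma conv_add_right:
  assumes "p \<in> coeff_fun" "q \<in> coeff_fun" "q' \<in> coeff_fun"
  shows "conv p (\<lambda>w. q w \<oplus> q' w) w = conv p q w \<oplus> conv p q' w"
  using assms by (simp add: conv_def coeff_fun_def r_distr finsum_addf Pi_def)

lemma conv_smult_left:
  assumes "c \<in> carrier R" "p \<in> coeff_fun" "q \<in> coeff_fun"
  shows "conv (\<lambda>w. c \<otimes> p w) q w = c \<otimes> conv p q w"
  using assms by (simp add: conv_def coeff_fun_def finsum_rdistr m_assoc Pi_def)

lemma conv_assoc:
  assumes "p \<in> coeff_fun" "q \<in> coeff_fun" "r \<in> coeff_fun"
  shows "conv (conv p q) r w = conv p (conv q r) w"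
  using assms
proof (induction w arbitrary: p)
  case Nil
  then show ?case by (simp add: conv_Nil conv_coeff_fun m_assoc coeff_funD)
next
  case (Cons a w)
  note c = Cons.prems
  let ?p = "\<lambda>v. p (a # v)" and ?q = "\<lambda>v. q (a # v)"
  have p': "?p \<in> coeff_fun" and q': "?q \<in> coeff_fun"
    using coeff_fun_shift[OF c(1)] coeff_fun_shift[OF c(2)] by simp_all
  have shift: "(\<lambda>v. conv p q (a # v)) = (\<lambda>v. p [] \<otimes> ?q v \<oplus> conv ?p q v)"
    using c by (simp add: conv_Cons)
  have "conv (conv p q) r (a # w)
      = (p [] \<otimes> q []) \<otimes> r (a # w) \<oplus> (p [] \<otimes> conv ?q r w \<oplus> conv (conv ?p q) r w)"
    using c p' q' by (simp add: conv_Cons[OF conv_coeff_fun] conv_Nil shift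
        conv_add_left conv_smult_left coeff_fun_smult conv_coeff_fun coeff_funD)
  also have "conv (conv ?p q) r w = conv ?p (conv q r) w" using Cons.IH[OF p'] c by simp
  also have "(p [] \<otimes> q []) \<otimes> r (a # w) \<oplus> (p [] \<otimes> conv ?q r w \<oplus> conv ?p (conv q r) w)
      = p [] \<otimes> (q [] \<otimes> r (a # w) \<oplus> conv ?q r w) \<oplus> conv ?p (conv q r) w"
    using coeff_funD[OF c(1), of "[]"] coeff_funD[OF c(2), of "[]"] coeff_funD[OF c(3), of "a # w"]
      conv_closed[OF q' c(3), of w] conv_closed[OF p' conv_coeff_fun[OF c(2,3)], of w]
    by (simp add: m_assoc a_assoc r_distr)
  also have "\<dots> = conv p (conv q r) (a # w)"
    using c by (simp add: conv_Cons conv_coeff_fun)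
  finally show ?case .
qed

text \<open>The monomial with coefficient \<open>c\<close> on the word \<open>u\<close>.\<close>

definition word_monom :: "'a \<Rightarrow> 'l list \<Rightarrow> 'l list \<Rightarrow> 'a" where
  "word_monom c u = (\<lambda>w. if w = u then c else \<zero>)"

lemma word_monom_coeff_fun: "c \<in> carrier R \<Longrightarrow> word_monom c u \<in> coeff_fun"
  by (simp add: word_monom_def coeff_fun_def)

lemma conv_zero_left: "q \<in> coeff_fun \<Longrightarrow> conv (\<lambda>w. \<zero>) q w = \<zero>"
  by (simp add: conv_def coeff_fun_def)

lemma conv_zero_right: "q \<in> coeff_fun \<Longrightarrow> conv q (\<lambda>w. \<zero>) w = \<zero>"
  by (simp add: conv_def coeff_fun_def)

lemma conv_const_left:
  assumes "c \<in> carrier R" "q \<in> coeff_fun"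
  shows "conv (word_monom c []) q w = c \<otimes> q w"
proof (cases w)
  case Nil
  then show ?thesis using assms by (simp add: conv_Nil word_monom_coeff_fun) (simp add: word_monom_def)
next
  case (Cons a v)
  have "(\<lambda>v. word_monom c [] (a # v)) = (\<lambda>v. \<zero>)" by (auto simp: word_monom_def)
  then show ?thesis using assms Cons
    by (simp add: conv_Cons word_monom_coeff_fun conv_zero_left coeff_funD) (simp add: word_monom_def coeff_funD)
qed

lemma conv_one_right:
  assumes "p \<in> coeff_fun"
  shows "conv p (word_monom \<one> []) w = p w"
  using assms
proof (induction w arbitrary: p)
  case Nil
  then show ?case by (simp add: conv_Nil word_monom_coeff_fun) (simp add: word_monom_def coeff_funD)
next
  case (Cons a w)
  then have "conv (\<lambda>v. p (a # v)) (word_monom \<one> []) w = p (a # w)"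
    by (intro Cons.IH coeff_fun_shift)
  then show ?case using Cons.prems
    by (simp add: conv_Cons word_monom_coeff_fun) (simp add: word_monom_def coeff_funD)
qed

lemma conv_word_monom:
  assumes "c \<in> carrier R" "d \<in> carrier R"
  shows "conv (word_monom c u) (word_monom d v) w = word_monom (c \<otimes> d) (u @ v) w"
proof (induction u arbitrary: w)
  case Nil
  then show ?case using assms
    by (simp add: conv_const_left word_monom_coeff_fun) (simp add: word_monom_def)
next
  case (Cons a u)
  show ?case
  proof (cases w)
    case Nil
    then show ?thesis using assms by (simp add: conv_Nil word_monom_coeff_fun) (simp add: word_monom_def)
  next
    case (Cons b w')
    have shift: "(\<lambda>v. word_monom c (a # u) (b # v)) = (if a = b then word_monom c u else (\<lambda>v. \<zero>))"
      by (auto simp: word_monom_def)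
    have "word_monom c (a # u) [] = \<zero>" by (simp add: word_monom_def)
    then have "conv (word_monom c (a # u)) (word_monom d v) w
        = conv (if a = b then word_monom c u else (\<lambda>v. \<zero>)) (word_monom d v) w'"
      using assms unfolding Cons
      by (simp add: conv_Cons word_monom_coeff_fun coeff_funD conv_closed shift conv_zero_left)
    also have "\<dots> = word_monom (c \<otimes> d) ((a # u) @ v) w"
    proof (cases "a = b")
      case True
      then show ?thesis using Cons.IH[of w'] Cons by (simp add: word_monom_def[of _ "_ @ _"] word_monom_def[of _ "_ # _"])
    next
      case False
      then show ?thesis using assms Cons conv_zero_left[OF word_monom_coeff_fun]
        by (simp add: word_monom_def[of _ "_ # _"])
    qed
    finally show ?thesis .
  qed
qed

lemma conv_support:
  assumes "p \<in> coeff_fun" "q \<in> coeff_fun" "conv p q w \<noteq> \<zero>"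
  obtains u v where "w = u @ v" "p u \<noteq> \<zero>" "q v \<noteq> \<zero>"
proof -
  have "\<exists>i \<le> length w. p (take i w) \<otimes> q (drop i w) \<noteq> \<zero>"
  proof (rule ccontr)
    assume "\<not> ?thesis"
    then have "conv p q w = (\<Oplus>i \<in> {..length w}. \<zero>)"
      unfolding conv_def by (intro finsum_cong') auto
    then show False using assms by simp
  qed
  then obtain i where "p (take i w) \<otimes> q (drop i w) \<noteq> \<zero>" by blast
  then have "p (take i w) \<noteq> \<zero>" "q (drop i w) \<noteq> \<zero>" using assms by (auto simp: coeff_fun_def)
  then show ?thesis using that[of "take i w" "drop i w"] by simp
qed

end

context field begin

lemma free_algebra_simps:
  "carrier (free_algebra R n) = {p \<in> coeff_fun. finite {w. p w \<noteq> \<zero>} \<and> (\<forall>w. p w \<noteq> \<zero> \<longrightarrow> set w \<subseteq> {..<n})}"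
  "mult (free_algebra R n) = conv"
  "one (free_algebra R n) = word_monom \<one> []"
  "zero (free_algebra R n) = (\<lambda>w. \<zero>)"
  "add (free_algebra R n) = (\<lambda>p q w. p w \<oplus> q w)"
  "smult (free_algebra R n) = (\<lambda>c p w. c \<otimes> p w)"
  by (auto simp: free_algebra_def coeff_fun_def conv_def word_monom_def fun_eq_iff)

lemma free_algebraI:
  assumes "p \<in> coeff_fun" "finite X" "\<And>w. p w \<noteq> \<zero> \<Longrightarrow> w \<in> X" "\<And>w. p w \<noteq> \<zero> \<Longrightarrow> set w \<subseteq> {..<n}"
  shows "p \<in> carrier (free_algebra R n)"
proof -
  have "finite {w. p w \<noteq> \<zero>}" by (rule finite_subset[OF _ assms(2)]) (use assms(3) in auto)
  then show ?thesis using assms by (simp add: free_algebra_simps)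
qed

lemma free_algebraD:
  assumes "p \<in> carrier (free_algebra R n)"
  shows "p \<in> coeff_fun" "finite {w. p w \<noteq> \<zero>}" "\<And>w. p w \<noteq> \<zero> \<Longrightarrow> set w \<subseteq> {..<n}"
  using assms by (simp_all add: free_algebra_simps)

lemma free_algebra_coeff: "p \<in> carrier (free_algebra R n) \<Longrightarrow> p w \<in> carrier R"
  by (rule coeff_funD[OF free_algebraD(1)])

lemma word_monom_in_free_algebra:
  assumes "c \<in> carrier R" "set u \<subseteq> {..<n}"
  shows "word_monom c u \<in> carrier (free_algebra R n)"
  by (rule free_algebraI[of _ "{u}"]) (use assms in \<open>auto simp: coeff_fun_def word_monom_def split: if_splits\<close>)

lemma add_in_free_algebra:
  assumes "p \<in> carrier (free_algebra R n)" "q \<in> carrier (free_algebra R n)"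
  shows "(\<lambda>w. p w \<oplus> q w) \<in> carrier (free_algebra R n)"
proof (rule free_algebraI)
  note p = free_algebraD[OF assms(1)] and q = free_algebraD[OF assms(2)]
  show "(\<lambda>w. p w \<oplus> q w) \<in> coeff_fun" by (rule coeff_fun_add[OF p(1) q(1)])
  show "finite ({w. p w \<noteq> \<zero>} \<union> {w. q w \<noteq> \<zero>})" using p q by simp
  fix w assume w: "p w \<oplus> q w \<noteq> \<zero>"
  then have "p w \<noteq> \<zero> \<or> q w \<noteq> \<zero>" by auto
  then show "w \<in> {w. p w \<noteq> \<zero>} \<union> {w. q w \<noteq> \<zero>}" "set w \<subseteq> {..<n}" using p(3) q(3) by auto
qed

lemma smult_in_free_algebra:
  assumes "c \<in> carrier R" "p \<in> carrier (free_algebra R n)"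
  shows "(\<lambda>w. c \<otimes> p w) \<in> carrier (free_algebra R n)"
proof (rule free_algebraI)
  note p = free_algebraD[OF assms(2)]
  show "(\<lambda>w. c \<otimes> p w) \<in> coeff_fun" by (rule coeff_fun_smult[OF assms(1) p(1)])
  show "finite {w. p w \<noteq> \<zero>}" by (rule p(2))
  fix w assume w: "c \<otimes> p w \<noteq> \<zero>"
  then have "p w \<noteq> \<zero>" using assms by auto
  then show "w \<in> {w. p w \<noteq> \<zero>}" "set w \<subseteq> {..<n}" using p(3) by auto
qed

lemma conv_in_free_algebra:
  assumes "p \<in> carrier (free_algebra R n)" "q \<in> carrier (free_algebra R n)"
  shows "conv p q \<in> carrier (free_algebra R n)"
proof (rule free_algebraI)
  note p = free_algebraD[OF assms(1)] and q = free_algebraD[OF assms(2)]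
  show "conv p q \<in> coeff_fun" by (rule conv_coeff_fun[OF p(1) q(1)])
  show "finite ((\<lambda>(u, v). u @ v) ` ({w. p w \<noteq> \<zero>} \<times> {w. q w \<noteq> \<zero>}))" using p q by simp
  fix w assume w: "conv p q w \<noteq> \<zero>"
  obtain u v where "w = u @ v" "p u \<noteq> \<zero>" "q v \<noteq> \<zero>" using conv_support[OF p(1) q(1) w] .
  then show "w \<in> (\<lambda>(u, v). u @ v) ` ({w. p w \<noteq> \<zero>} \<times> {w. q w \<noteq> \<zero>})" "set w \<subseteq> {..<n}"
    using p(3) q(3) by force+
qed

lemma zero_in_free_algebra: "(\<lambda>w. \<zero>) \<in> carrier (free_algebra R n)"
  by (simp add: free_algebra_simps coeff_fun_def)

lemma ring_free_algebra: "ring (free_algebra R n)"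
proof (rule ringI)
  show "abelian_group (free_algebra R n)"
  proof (rule abelian_groupI, unfold free_algebra_simps(4,5))
    fix p assume p: "p \<in> carrier (free_algebra R n)"
    have "(\<lambda>w. (\<ominus> \<one>) \<otimes> p w) \<in> carrier (free_algebra R n)"
      using smult_in_free_algebra[of "\<ominus> \<one>", OF _ p] by simp
    moreover have "(\<lambda>w. ((\<ominus> \<one>) \<otimes> p w) \<oplus> p w) = (\<lambda>w. \<zero>)"
      using free_algebra_coeff[OF p] by (simp add: fun_eq_iff l_minus l_neg)
    ultimately show "\<exists>q \<in> carrier (free_algebra R n). (\<lambda>w. q w \<oplus> p w) = (\<lambda>w. \<zero>)"
      by (intro bexI[where x = "\<lambda>w. (\<ominus> \<one>) \<otimes> p w"])
  qed (simp_all add: add_in_free_algebra zero_in_free_algebra fun_eq_iff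
      free_algebra_coeff[of _ n] a_ac)
  show "Group.monoid (free_algebra R n)"
  proof (rule monoidI, unfold free_algebra_simps(2,3))
    show "word_monom \<one> [] \<in> carrier (free_algebra R n)"
      by (rule word_monom_in_free_algebra) auto
  qed (simp_all add: conv_in_free_algebra fun_eq_iff conv_assoc conv_const_left conv_one_right
      free_algebraD(1)[of _ n] free_algebra_coeff[of _ n])
qed (simp_all add: free_algebra_simps(2,5) fun_eq_iff conv_add_left conv_add_right free_algebraD(1)[of _ n])

lemma free_algebra_smult_eq:
  assumes "c \<in> carrier R" "p \<in> carrier (free_algebra R n)"
  shows "c \<odot>\<^bsub>free_algebra R n\<^esub> p = word_monom c [] \<otimes>\<^bsub>free_algebra R n\<^esub> p"
  using conv_const_left[OF assms(1) free_algebraD(1)[OF assms(2)]]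
  by (simp add: free_algebra_simps(2,6) fun_eq_iff)

lemma free_algebra_induct [consumes 1, case_names zero add]:
  assumes "p \<in> carrier (free_algebra R n)"
    and zero: "Q (\<lambda>w. \<zero>)"
    and add: "\<And>p c u. \<lbrakk>p \<in> carrier (free_algebra R n); c \<in> carrier R; set u \<subseteq> {..<n}; Q p\<rbrakk>
      \<Longrightarrow> Q (\<lambda>w. p w \<oplus> word_monom c u w)"
  shows "Q p"
proof -
  have "\<lbrakk>p \<in> carrier (free_algebra R n); {w. p w \<noteq> \<zero>} \<subseteq> X\<rbrakk> \<Longrightarrow> Q p" if "finite X" for X p
    using that
  proof (induction X arbitrary: p rule: finite_induct)
    case empty
    then have "p = (\<lambda>w. \<zero>)" by auto
    then show ?case using zero by simp
  next
    case (insert u X)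
    show ?case
    proof (cases "p u = \<zero>")
      case True
      with insert.prems have "{w. p w \<noteq> \<zero>} \<subseteq> X" by auto
      then show ?thesis using insert by blast
    next
      case False
      note p = free_algebraD[OF insert.prems(1)]
      define q where "q = (\<lambda>w. if w = u then \<zero> else p w)"
      have q: "q \<in> carrier (free_algebra R n)"
        by (rule free_algebraI[OF _ p(2)])
          (use p(1,3) in \<open>auto simp: q_def coeff_fun_def split: if_splits\<close>)
      have "{w. q w \<noteq> \<zero>} \<subseteq> X" using insert.prems(2) by (auto simp: q_def split: if_splits)
      then have "Q q" using insert.IH q by blast
      then have "Q (\<lambda>w. q w \<oplus> word_monom (p u) u w)"
        using add[OF q] p False coeff_funD by blast
      moreover have "(\<lambda>w. q w \<oplus> word_monom (p u) u w) = p"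
        using coeff_funD[OF p(1)] by (auto simp: q_def word_monom_def fun_eq_iff)
      ultimately show ?thesis by simp
    qed
  qed
  from this[OF free_algebraD(2)[OF assms(1)] assms(1)] show ?thesis by simp
qed

end

text \<open>A space \<open>T\<close> of functions supported in a finite set has a finite spanning set. Spanning is expressed by
  closure: every \<open>J\<close> containing \<open>S\<close> and closed under linear combinations contains \<open>T\<close>. Induction on the
  support: if some \<open>p0 \<in> T\<close> is nonzero at the new point, it is added to a spanning set of the functions
  in \<open>T\<close> that vanish there.\<close>

lemma finite_spanning_subset:
  fixes K (structure)
  assumes "field K" "finite X"
    and "T \<subseteq> {p. (\<forall>w. p w \<in> carrier K) \<and> (\<forall>w. p w \<noteq> \<zero> \<longrightarrow> w \<in> X)}"
    and "\<And>p q. \<lbrakk>p \<in> T; q \<in> T\<rbrakk> \<Longrightarrow> (\<lambda>w. p w \<oplus> q w) \<in> T"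
    and "\<And>c p. \<lbrakk>c \<in> carrier K; p \<in> T\<rbrakk> \<Longrightarrow> (\<lambda>w. c \<otimes> p w) \<in> T"
  shows "\<exists>S \<subseteq> T. finite S \<and> (\<forall>J. S \<subseteq> J \<and> (\<lambda>w. \<zero>) \<in> J
      \<and> (\<forall>p \<in> J. \<forall>q \<in> J. (\<lambda>w. p w \<oplus> q w) \<in> J)
      \<and> (\<forall>c \<in> carrier K. \<forall>p \<in> J. (\<lambda>w. c \<otimes> p w) \<in> J) \<longrightarrow> T \<subseteq> J)"
  using assms(2-5)
proof (induction X arbitrary: T rule: finite_induct)
  case empty
  then have "T \<subseteq> {\<lambda>w. \<zero>}" by auto
  then show ?case by (intro exI[of _ "{}"]) auto
next
  case (insert x X)
  interpret field K by fact
  let ?T = "{p \<in> T. p x = \<zero>}"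
  have "\<exists>S \<subseteq> ?T. finite S \<and> (\<forall>J. S \<subseteq> J \<and> (\<lambda>w. \<zero>) \<in> J
      \<and> (\<forall>p \<in> J. \<forall>q \<in> J. (\<lambda>w. p w \<oplus> q w) \<in> J)
      \<and> (\<forall>c \<in> carrier K. \<forall>p \<in> J. (\<lambda>w. c \<otimes> p w) \<in> J) \<longrightarrow> ?T \<subseteq> J)"
    using insert.prems by (intro insert.IH) auto
  then obtain S where S: "S \<subseteq> ?T" "finite S"
    and SJ: "\<And>J. \<lbrakk>S \<subseteq> J; (\<lambda>w. \<zero>) \<in> J; \<forall>p \<in> J. \<forall>q \<in> J. (\<lambda>w. p w \<oplus> q w) \<in> J;
      \<forall>c \<in> carrier K. \<forall>p \<in> J. (\<lambda>w. c \<otimes> p w) \<in> J\<rbrakk> \<Longrightarrow> ?T \<subseteq> J" by auto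
  show ?case
  proof (cases "?T = T")
    case True
    then show ?thesis using S SJ by (intro exI[of _ S]) auto
  next
    case False
    then obtain p0 where p0: "p0 \<in> T" "p0 x \<noteq> \<zero>" by blast
    have p0c: "p0 w \<in> carrier K" for w using p0 insert.prems(1) by auto
    have "T \<subseteq> J" if J: "insert p0 S \<subseteq> J" "(\<lambda>w. \<zero>) \<in> J" "\<forall>p \<in> J. \<forall>q \<in> J. (\<lambda>w. p w \<oplus> q w) \<in> J"
      "\<forall>c \<in> carrier K. \<forall>p \<in> J. (\<lambda>w. c \<otimes> p w) \<in> J" for J
    proof
      fix p assume p: "p \<in> T"
      have pc: "p w \<in> carrier K" for w using p insert.prems(1) by auto
      define c where "c = p x \<otimes> inv (p0 x)"
      have inv: "inv (p0 x) \<in> carrier K" "inv (p0 x) \<otimes> p0 x = \<one>"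
        using p0(2) p0c field_Units by auto
      then have c: "c \<in> carrier K" "c \<otimes> p0 x = p x"
        using pc p0c by (auto simp: c_def m_assoc)
      define q where "q = (\<lambda>w. p w \<oplus> (\<ominus> c) \<otimes> p0 w)"
      have "(\<lambda>w. (\<ominus> c) \<otimes> p0 w) \<in> T" using insert.prems(3)[of "\<ominus> c" p0] c p0 by simp
      then have "q \<in> T" unfolding q_def using insert.prems(2)[OF p] by blast
      moreover have "q x = \<zero>" unfolding q_def using c p0c[of x] pc[of x] by (simp add: l_minus r_neg)
      ultimately have "q \<in> J" using SJ[of J] J by blast
      moreover have "(\<lambda>w. c \<otimes> p0 w) \<in> J" using J c by blast
      ultimately have "(\<lambda>w. q w \<oplus> c \<otimes> p0 w) \<in> J" using J(3)[rule_format, of q] by simp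
      moreover have "q w \<oplus> c \<otimes> p0 w = p w" for w
        unfolding q_def using c pc[of w] p0c[of w] by algebra
      ultimately show "p \<in> J" by simp
    qed
    moreover have "insert p0 S \<subseteq> T" "finite (insert p0 S)" using S p0 by auto
    ultimately show ?thesis by (intro exI[of _ "insert p0 S"]) auto
  qed
qed

text \<open>Evaluation of noncommutative polynomials at a sequence \<open>g\<close> of elements of the algebra \<open>A\<close>. The
  sequence is total; the values beyond the number of variables are never used.\<close>

locale word_evaluation = assoc_algebra K A for K and A (structure) +
  fixes g :: "nat \<Rightarrow> _"
  assumes g_closed: "g i \<in> carrier A"
begin

text \<open>The product in \<open>A\<close> of the letters of a word.\<close>

definition word_val :: "nat list \<Rightarrow> _" where
  "word_val w = foldr (\<lambda>i x. g i \<otimes> x) w \<one>"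

text \<open>The value of a polynomial; the sum runs over its support.\<close>

definition eval :: "(nat list \<Rightarrow> _) \<Rightarrow> _" where
  "eval p = (\<Oplus>w \<in> {w. p w \<noteq> \<zero>\<^bsub>K\<^esub>}. p w \<odot> word_val w)"

lemma word_val_closed: "word_val w \<in> carrier A"
  by (induction w) (auto simp: word_val_def g_closed)

lemma word_val_append: "word_val (u @ v) = word_val u \<otimes> word_val v"
proof (induction u)
  case Nil then show ?case using word_val_closed by (simp add: word_val_def)
next
  case (Cons i u)
  then show ?case using word_val_closed[of u] word_val_closed[of v] g_closed[of i]
    by (simp add: word_val_def m_assoc)
qed

lemma eval_superset:
  assumes "finite X" "{w. p w \<noteq> \<zero>\<^bsub>K\<^esub>} \<subseteq> X" "p \<in> coeff_fun"
  shows "eval p = (\<Oplus>w \<in> X. p w \<odot> word_val w)"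
  unfolding eval_def using assms
  by (intro M.add.finprod_mono_neutral_cong_left) (auto simp: word_val_closed coeff_funD)

lemma eval_closed: "p \<in> carrier (free_algebra K n) \<Longrightarrow> eval p \<in> carrier A"
  unfolding eval_def
  by (rule M.finsum_closed) (auto simp: word_val_closed free_algebra_coeff)

lemma eval_zero: "eval (\<lambda>w. \<zero>\<^bsub>K\<^esub>) = \<zero>"
  by (simp add: eval_def)

lemma eval_add:
  assumes p: "p \<in> carrier (free_algebra K n)" and q: "q \<in> carrier (free_algebra K n)"
  shows "eval (\<lambda>w. p w \<oplus>\<^bsub>K\<^esub> q w) = eval p \<oplus> eval q"
proof -
  let ?X = "{w. p w \<noteq> \<zero>\<^bsub>K\<^esub>} \<union> {w. q w \<noteq> \<zero>\<^bsub>K\<^esub>}"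
  have fin: "finite ?X" using free_algebraD(2)[OF p] free_algebraD(2)[OF q] by simp
  have c: "p w \<in> carrier K" "q w \<in> carrier K" for w
    by (rule free_algebra_coeff[OF p], rule free_algebra_coeff[OF q])
  have "eval (\<lambda>w. p w \<oplus>\<^bsub>K\<^esub> q w) = (\<Oplus>w \<in> ?X. (p w \<oplus>\<^bsub>K\<^esub> q w) \<odot> word_val w)"
  proof (rule eval_superset[OF fin])
    show "{w. p w \<oplus>\<^bsub>K\<^esub> q w \<noteq> \<zero>\<^bsub>K\<^esub>} \<subseteq> ?X" by auto
    show "(\<lambda>w. p w \<oplus>\<^bsub>K\<^esub> q w) \<in> coeff_fun"
      by (rule free_algebraD(1)[OF add_in_free_algebra[OF p q]])
  qed
  also have "\<dots> = (\<Oplus>w \<in> ?X. p w \<odot> word_val w \<oplus> q w \<odot> word_val w)"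
    using c word_val_closed by (simp add: smult_l_distr)
  also have "\<dots> = (\<Oplus>w \<in> ?X. p w \<odot> word_val w) \<oplus> (\<Oplus>w \<in> ?X. q w \<odot> word_val w)"
    using c word_val_closed by (intro M.finsum_addf) auto
  also have "(\<Oplus>w \<in> ?X. p w \<odot> word_val w) = eval p"
    by (rule eval_superset[symmetric, OF fin _ free_algebraD(1)[OF p]]) simp
  also have "(\<Oplus>w \<in> ?X. q w \<odot> word_val w) = eval q"
    by (rule eval_superset[symmetric, OF fin _ free_algebraD(1)[OF q]]) simp
  finally show ?thesis .
qed

lemma eval_word_monom:
  assumes "c \<in> carrier K"
  shows "eval (word_monom c u) = c \<odot> word_val u"
proof -
  have "eval (word_monom c u) = (\<Oplus>w \<in> {u}. word_monom c u w \<odot> word_val w)"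
    by (rule eval_superset) (use assms in \<open>auto simp: word_monom_def coeff_fun_def split: if_splits\<close>)
  then show ?thesis
    using assms by (simp add: word_monom_def word_val_closed)
qed

lemma eval_conv_monom:
  assumes c: "c \<in> carrier K" "set u \<subseteq> {..<n}" and q: "q \<in> carrier (free_algebra K n)"
  shows "eval (conv (word_monom c u) q) = eval (word_monom c u) \<otimes> eval q"
  using q
proof (induction q rule: free_algebra_induct)
  case zero
  have "conv (word_monom c u) (\<lambda>w. \<zero>\<^bsub>K\<^esub>) = (\<lambda>w. \<zero>\<^bsub>K\<^esub>)"
    by (rule ext) (rule conv_zero_right[OF word_monom_coeff_fun[OF c(1)]])
  then show ?case using c by (simp add: eval_zero eval_word_monom word_val_closed)
next
  case (add q d v)
  let ?m = "word_monom c u" and ?m' = "word_monom d v"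
  have m: "?m \<in> carrier (free_algebra K n)" "?m' \<in> carrier (free_algebra K n)"
    using c add by (auto intro: word_monom_in_free_algebra)
  have "conv ?m (\<lambda>w. q w \<oplus>\<^bsub>K\<^esub> ?m' w) = (\<lambda>w. conv ?m q w \<oplus>\<^bsub>K\<^esub> conv ?m ?m' w)"
    by (rule ext)
      (rule conv_add_right[OF free_algebraD(1)[OF m(1)] free_algebraD(1)[OF add(1)] free_algebraD(1)[OF m(2)]])
  then have "eval (conv ?m (\<lambda>w. q w \<oplus>\<^bsub>K\<^esub> ?m' w)) = eval (\<lambda>w. conv ?m q w \<oplus>\<^bsub>K\<^esub> conv ?m ?m' w)"
    by (rule arg_cong)
  also have "\<dots> = eval (conv ?m q) \<oplus> eval (conv ?m ?m')"
    using m add by (intro eval_add conv_in_free_algebra)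
  also have "conv ?m ?m' = word_monom (c \<otimes>\<^bsub>K\<^esub> d) (u @ v)"
    using conv_word_monom c add by blast
  also have "eval (word_monom (c \<otimes>\<^bsub>K\<^esub> d) (u @ v)) = (c \<otimes>\<^bsub>K\<^esub> d) \<odot> (word_val u \<otimes> word_val v)"
    using c add by (simp add: eval_word_monom word_val_append)
  also have "\<dots> = c \<odot> (d \<odot> (word_val u \<otimes> word_val v))"
    using c add word_val_closed by (simp add: smult_assoc1)
  also have "\<dots> = c \<odot> (word_val u \<otimes> (d \<odot> word_val v))"
    using smult_mult_right[of d "word_val u" "word_val v"] add word_val_closed by simp
  also have "\<dots> = (c \<odot> word_val u) \<otimes> (d \<odot> word_val v)"
    using smult_mult_left[of c "word_val u" "d \<odot> word_val v"] c add word_val_closed by simp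
  also have "\<dots> = eval ?m \<otimes> eval ?m'" using c add by (simp add: eval_word_monom)
  also have "eval (conv ?m q) \<oplus> eval ?m \<otimes> eval ?m' = eval ?m \<otimes> (eval q \<oplus> eval ?m')"
    using add(4) eval_closed[OF m(1)] eval_closed[OF m(2)] eval_closed[OF add(1)] by (simp add: r_distr)
  also have "eval q \<oplus> eval ?m' = eval (\<lambda>w. q w \<oplus>\<^bsub>K\<^esub> ?m' w)"
    using eval_add[OF add(1) m(2)] by simp
  finally show ?case .
qed

lemma eval_conv:
  assumes p: "p \<in> carrier (free_algebra K n)" and q: "q \<in> carrier (free_algebra K n)"
  shows "eval (conv p q) = eval p \<otimes> eval q"
  using p
proof (induction p rule: free_algebra_induct)
  case zero
  have "conv (\<lambda>w. \<zero>\<^bsub>K\<^esub>) q = (\<lambda>w. \<zero>\<^bsub>K\<^esub>)"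
    by (rule ext) (rule conv_zero_left[OF free_algebraD(1)[OF q]])
  then show ?case using eval_closed[OF q] by (simp add: eval_zero)
next
  case (add p c u)
  let ?m = "word_monom c u"
  have m: "?m \<in> carrier (free_algebra K n)"
    using add by (auto intro: word_monom_in_free_algebra)
  have "conv (\<lambda>w. p w \<oplus>\<^bsub>K\<^esub> ?m w) q = (\<lambda>w. conv p q w \<oplus>\<^bsub>K\<^esub> conv ?m q w)"
    by (rule ext)
      (rule conv_add_left[OF free_algebraD(1)[OF add(1)] free_algebraD(1)[OF m] free_algebraD(1)[OF q]])
  then have "eval (conv (\<lambda>w. p w \<oplus>\<^bsub>K\<^esub> ?m w) q) = eval (\<lambda>w. conv p q w \<oplus>\<^bsub>K\<^esub> conv ?m q w)"
    by (rule arg_cong)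
  also have "\<dots> = eval (conv p q) \<oplus> eval (conv ?m q)"
    using m add q by (intro eval_add conv_in_free_algebra)
  also have "\<dots> = (eval p \<oplus> eval ?m) \<otimes> eval q"
    using add eval_conv_monom[OF add(2,3) q] eval_closed[OF m] eval_closed[OF q] eval_closed[OF add(1)]
    by (simp add: l_distr)
  also have "eval p \<oplus> eval ?m = eval (\<lambda>w. p w \<oplus>\<^bsub>K\<^esub> ?m w)"
    using eval_add[OF add(1) m] by simp
  finally show ?case .
qed

lemma eval_one: "eval (word_monom \<one>\<^bsub>K\<^esub> []) = \<one>"
  by (simp add: eval_word_monom word_val_def)

lemma eval_ring_hom: "ring_hom_ring (free_algebra K n) A eval"
proof (rule ring_hom_ringI2)
  show "ring (free_algebra K n)" by (rule ring_free_algebra)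
  show "ring A" by (rule ring_axioms)
  show "eval \<in> ring_hom (free_algebra K n) A"
    by (rule ring_hom_memI) (simp_all add: free_algebra_simps(2,3,5) eval_closed[of _ n] eval_conv[of _ n] eval_add[of _ n] eval_one)
qed

lemma eval_smult:
  assumes "c \<in> carrier K" "p \<in> carrier (free_algebra K n)"
  shows "eval (\<lambda>w. c \<otimes>\<^bsub>K\<^esub> p w) = c \<odot> eval p"
proof -
  have "(\<lambda>w. c \<otimes>\<^bsub>K\<^esub> p w) = conv (word_monom c []) p"
    using conv_const_left[OF assms(1) free_algebraD(1)[OF assms(2)]] by (simp add: fun_eq_iff)
  then have "eval (\<lambda>w. c \<otimes>\<^bsub>K\<^esub> p w) = (c \<odot> \<one>) \<otimes> eval p"
    using eval_conv_monom[OF assms(1) _ assms(2), of "[]"] assms(1)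
    by (simp add: eval_word_monom word_val_def)
  then show ?thesis using assms eval_closed[OF assms(2)] by (simp add: smult_mult_left)
qed

end

context field begin

text \<open>Combinations of words of length at most \<open>k\<close> in \<open>n\<close> letters.\<close>

definition short_words :: "nat \<Rightarrow> nat \<Rightarrow> (nat list \<Rightarrow> 'a) set" where
  "short_words n k = {p \<in> carrier (free_algebra R n). \<forall>w. p w \<noteq> \<zero> \<longrightarrow> length w \<le> k}"

lemma short_words_add: "\<lbrakk>p \<in> short_words n k; q \<in> short_words n k\<rbrakk> \<Longrightarrow> (\<lambda>w. p w \<oplus> q w) \<in> short_words n k"
proof -
  assume pq: "p \<in> short_words n k" "q \<in> short_words n k"
  have "length w \<le> k" if "p w \<oplus> q w \<noteq> \<zero>" for w
  proof -
    have "p w \<noteq> \<zero> \<or> q w \<noteq> \<zero>" using that by auto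
    then show ?thesis using pq by (auto simp: short_words_def)
  qed
  then show ?thesis using pq add_in_free_algebra by (simp add: short_words_def)
qed

lemma short_words_smult: "\<lbrakk>c \<in> carrier R; p \<in> short_words n k\<rbrakk> \<Longrightarrow> (\<lambda>w. c \<otimes> p w) \<in> short_words n k"
proof -
  assume c: "c \<in> carrier R" and p: "p \<in> short_words n k"
  have "length w \<le> k" if "c \<otimes> p w \<noteq> \<zero>" for w
  proof -
    have "p w \<noteq> \<zero>" using that c by auto
    then show ?thesis using p by (auto simp: short_words_def)
  qed
  then show ?thesis using c p smult_in_free_algebra by (simp add: short_words_def)
qed

lemma short_words_mono: "k \<le> l \<Longrightarrow> short_words n k \<subseteq> short_words n l"
  by (force simp: short_words_def)

lemma short_words_conv: "\<lbrakk>p \<in> short_words n k; q \<in> short_words n l\<rbrakk> \<Longrightarrow> conv p q \<in> short_words n (k + l)"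
proof -
  assume p: "p \<in> short_words n k" and q: "q \<in> short_words n l"
  then have pq: "p \<in> carrier (free_algebra R n)" "q \<in> carrier (free_algebra R n)"
    by (simp_all add: short_words_def)
  have "length w \<le> k + l" if w: "conv p q w \<noteq> \<zero>" for w
  proof -
    obtain u v where "w = u @ v" "p u \<noteq> \<zero>" "q v \<noteq> \<zero>"
      using conv_support[OF free_algebraD(1)[OF pq(1)] free_algebraD(1)[OF pq(2)] w] .
    then show ?thesis using p q by (auto simp: short_words_def intro!: add_mono)
  qed
  then show ?thesis using conv_in_free_algebra[OF pq] by (simp add: short_words_def)
qed

lemma word_monom_short: "\<lbrakk>c \<in> carrier R; set u \<subseteq> {..<n}; length u \<le> k\<rbrakk> \<Longrightarrow> word_monom c u \<in> short_words n k"
  by (simp add: short_words_def word_monom_in_free_algebra) (simp add: word_monom_def)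

lemma free_algebra_neg:
  assumes "p \<in> carrier (free_algebra R n)"
  shows "\<ominus>\<^bsub>free_algebra R n\<^esub> p = (\<lambda>w. (\<ominus> \<one>) \<otimes> p w)"
proof -
  interpret P: ring "free_algebra R n" by (rule ring_free_algebra)
  have "(\<lambda>w. (\<ominus> \<one>) \<otimes> p w) \<oplus>\<^bsub>free_algebra R n\<^esub> p = \<zero>\<^bsub>free_algebra R n\<^esub>"
    using free_algebra_coeff[OF assms] by (simp add: free_algebra_simps(4,5) l_minus l_neg)
  then show ?thesis
    using P.minus_equality assms smult_in_free_algebra[OF _ assms, of "\<ominus> \<one>"] by simp
qed

lemma short_words_subgroup: "additive_subgroup (short_words n k) (free_algebra R n)"
proof -
  interpret P: ring "free_algebra R n" by (rule ring_free_algebra)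
  show ?thesis
  proof (rule additive_subgroupI, rule P.add.subgroupI)
    show sub: "short_words n k \<subseteq> carrier (free_algebra R n)" by (auto simp: short_words_def)
    have "(\<lambda>w. \<zero>) \<in> short_words n k" by (simp add: short_words_def zero_in_free_algebra)
    then show "short_words n k \<noteq> {}" by blast
    fix p q assume p: "p \<in> short_words n k" and q: "q \<in> short_words n k"
    show "\<ominus>\<^bsub>free_algebra R n\<^esub> p \<in> short_words n k"
      using short_words_smult[of "\<ominus> \<one>", OF _ p] free_algebra_neg[OF subsetD[OF sub p]] by simp
    show "p \<oplus>\<^bsub>free_algebra R n\<^esub> q \<in> short_words n k"
      using short_words_add[OF p q] by (simp add: free_algebra_simps(5))
  qed
qed

lemma short_words_generate:
  assumes "short_words n 1 \<subseteq> X"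
    and add: "\<And>p q. \<lbrakk>p \<in> X; q \<in> X\<rbrakk> \<Longrightarrow> p \<oplus>\<^bsub>free_algebra R n\<^esub> q \<in> X"
    and mult: "\<And>p q. \<lbrakk>p \<in> X; q \<in> X\<rbrakk> \<Longrightarrow> p \<otimes>\<^bsub>free_algebra R n\<^esub> q \<in> X"
  shows "carrier (free_algebra R n) \<subseteq> X"
proof
  have monom: "word_monom c u \<in> X" if "c \<in> carrier R" "set u \<subseteq> {..<n}" for c u
    using that(2)
  proof (induction u)
    case Nil
    then show ?case using assms(1) word_monom_short[OF that(1), of "[]" n 1] by auto
  next
    case (Cons a u)
    have "word_monom \<one> [a] \<in> X" using assms(1) word_monom_short[of \<one> "[a]" n 1] Cons.prems by auto
    then have "conv (word_monom \<one> [a]) (word_monom c u) \<in> X"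
      using mult Cons by (simp add: free_algebra_simps(2))
    moreover have "conv (word_monom \<one> [a]) (word_monom c u) = word_monom c (a # u)"
      using conv_word_monom[of \<one> c "[a]" u] that(1) by (simp add: fun_eq_iff)
    ultimately show ?case by simp
  qed
  fix p assume "p \<in> carrier (free_algebra R n)"
  then show "p \<in> X"
  proof (induction p rule: free_algebra_induct)
    case zero
    have "(\<lambda>w. \<zero>) \<in> short_words n 1" by (simp add: short_words_def zero_in_free_algebra)
    then show ?case using assms(1) by blast
  next
    case (add p c u)
    then show ?case using assms(2)[of p "word_monom c u"] monom by (simp add: free_algebra_simps(5))
  qed
qed

end

section \<open>Finite generation over the associated graded ring\<close>

lemma (in ring) additive_subgroup_abelian_group:
  assumes "additive_subgroup N R"
  shows "abelian_group (R\<lparr>carrier := N\<rparr>)"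
proof (rule abelian_groupI, simp_all)
  interpret N: additive_subgroup N R by fact
  show "\<zero> \<in> N" "\<And>x y. x \<in> N \<Longrightarrow> y \<in> N \<Longrightarrow> x \<oplus> y \<in> N" by simp_all
  show "\<exists>y\<in>N. y \<oplus> x = \<zero>" if "x \<in> N" for x
    using that N.a_inv_closed[OF that] by (intro bexI[of _ "\<ominus> x"]) (simp_all add: l_neg)
qed (auto dest!: additive_subgroup.a_Hcarr[OF assms] intro: a_assoc a_comm)

context fin_dim_filtration begin

text \<open>The given filtration, extended by zero to negative indices.\<close>

definition Fz :: "int \<Rightarrow> _ set" where
  "Fz n = (if n < 0 then {\<zero>} else Fil (nat n))"

lemma Fil_additive_subgroup: "additive_subgroup (Fil i) A"
proof -
  interpret S: submodule K "Fil i" A by (rule subspace.submod[OF Fil_subspace])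
  show ?thesis
  proof (rule additive_subgroupI, rule add.subgroupI)
    show "Fil i \<subseteq> carrier A" by (rule S.subset)
    show "Fil i \<noteq> {}" using S.zero_closed by blast
    fix x assume x: "x \<in> Fil i"
    then have "x \<in> carrier A" using S.subset by blast
    then have "\<ominus> x = (\<ominus>\<^bsub>K\<^esub> \<one>\<^bsub>K\<^esub>) \<odot> x" by (simp add: smult_l_minus)
    then show "\<ominus> x \<in> Fil i" using x S.smult_closed by simp
  qed simp
qed

lemma int_filtration_Fz: "int_filtration A Fz"
proof (intro int_filtration.intro int_filtration_axioms.intro)
  show "ring A" by (rule ring_axioms)
  have Fil: "Fil i \<subseteq> carrier A" for i
    using additive_subgroup.a_subset[OF Fil_additive_subgroup] .
  show "additive_subgroup (Fz n) A" for n
    using Fil_additive_subgroup add.triv_subgroup by (auto simp: Fz_def additive_subgroup_def)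
  have zero: "\<zero> \<in> Fil i" for i using additive_subgroup.zero_closed[OF Fil_additive_subgroup] .
  show "Fz n \<subseteq> Fz (n + 1)" for n
    using Fil_ascending[of "nat n"] zero by (auto simp: Fz_def nat_add_distrib)
  show "x \<otimes> y \<in> Fz (m + n)" if "x \<in> Fz m" "y \<in> Fz n" for x y m n
  proof (cases "m < 0 \<or> n < 0")
    case True
    then have "x = \<zero> \<or> y = \<zero>" using that by (auto simp: Fz_def)
    moreover have "x \<in> carrier A" "y \<in> carrier A"
      using that Fil by (auto simp: Fz_def split: if_splits)
    ultimately show ?thesis using zero by (auto simp: Fz_def)
  next
    case False
    then show ?thesis using that Fil_mult by (auto simp: Fz_def nat_add_distrib)
  qed
qed

lemma Fil_pred_Fz: "Fil_pred A Fil i = Fz (int i - 1)"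
  by (cases i) (auto simp: Fil_pred_def Fz_def)

lemma Fil_Fz: "x \<in> Fil i \<longleftrightarrow> x \<in> Fz (int i)"
  by (simp add: Fz_def)

end

sublocale fin_dim_filtration \<subseteq> Z: int_filtration A Fz
  by (rule int_filtration_Fz)

context fin_dim_filtration begin

text \<open>\<open>H i\<close> is the subspace divided out in degree \<open>i\<close>.\<close>

abbreviation H :: "nat \<Rightarrow> _ set" where "H i \<equiv> Fil_pred A Fil i"
abbreviation Gr where "Gr \<equiv> assoc_graded A Fil"

lemma H_subgroup: "additive_subgroup (H i) A"
  unfolding Fil_pred_Fz by (rule Z.F_subgroup)

lemma H_abelian_subgroup: "abelian_subgroup (H i) A"
  by (rule abelian_subgroupI3[OF H_subgroup abelian_group_axioms])

lemma H_Fil: "H i \<subseteq> Fil i"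
  unfolding Fil_pred_Fz by (rule subsetI, unfold Fil_Fz, rule Z.F_mono[of "int i - 1"]) simp_all

lemma gr_piece_carrier: "carrier (gr_piece A Fil i) = {H i +> a |a. a \<in> Fil i}"
  by (auto simp: gr_piece_def A_FactGroup_def' A_RCOSETS_def' a_r_coset_def r_coset_def)

lemma gr_piece_comm_group: "comm_group (gr_piece A Fil i)"
  unfolding gr_piece_def
proof (rule abelian_subgroup.a_factorgroup_is_comm_group, rule abelian_subgroupI3)
  interpret S: additive_subgroup "H i" A by (rule H_subgroup)
  show "abelian_group (A\<lparr>carrier := Fil i\<rparr>)"
    by (rule additive_subgroup_abelian_group[OF Fil_additive_subgroup])
  then interpret F: abelian_group "A\<lparr>carrier := Fil i\<rparr>" .
  show "additive_subgroup (H i) (A\<lparr>carrier := Fil i\<rparr>)"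
  proof (rule additive_subgroupI, rule F.add.subgroupI)
    show "H i \<noteq> {}" using S.zero_closed by blast
    fix x assume x: "x \<in> H i"
    have "\<ominus>\<^bsub>A\<lparr>carrier := Fil i\<rparr>\<^esub> x = \<ominus> x"
      using x H_Fil Fil_Fz Z.F_neg Z.F_carrier by (intro F.minus_equality) (auto simp: l_neg)
    then show "\<ominus>\<^bsub>A\<lparr>carrier := Fil i\<rparr>\<^esub> x \<in> H i"
      using S.a_inv_closed[OF x] by simp
  qed (use H_Fil in auto)
qed

lemma gr_piece_mult: "X \<otimes>\<^bsub>gr_piece A Fil i\<^esub> Y = X <+>\<^bsub>A\<^esub> Y"
  by (simp add: gr_piece_def A_FactGroup_def' set_add_def set_mult_def)

lemma gr_piece_one: "\<one>\<^bsub>gr_piece A Fil i\<^esub> = H i"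
  by (simp add: gr_piece_def A_FactGroup_def')

lemma coset_eq:
  assumes "z \<in> H i +> a" "a \<in> carrier A"
  shows "H i +> a = H i +> z"
  using abelian_subgroup.a_repr_independence'[OF H_abelian_subgroup assms] .

text \<open>The product of two cosets does not depend on the representatives.\<close>

lemma rcoset_mult_gr:
  assumes "a \<in> Fil i" "b \<in> Fil j"
  shows "rcoset_mult A (H (i + j)) (H i +> a) (H j +> b) = H (i + j) +> (a \<otimes> b)"
proof -
  have ab: "a \<in> carrier A" "b \<in> carrier A" using assms Z.F_carrier by (auto simp: Fil_Fz)
  have "H (i + j) +> (a' \<otimes> b') = H (i + j) +> (a \<otimes> b)" if "a' \<in> H i +> a" "b' \<in> H j +> b" for a' b'
  proof -
    from that obtain h k where h: "h \<in> H i" "a' = h \<oplus> a" and k: "k \<in> H j" "b' = k \<oplus> b"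
      by (auto simp: a_r_coset_def')
    have hk: "h \<in> carrier A" "k \<in> carrier A" using h k Z.F_carrier by (auto simp: Fil_pred_Fz)
    have "h \<otimes> (k \<oplus> b) \<in> Fz (int (i + j) - 1)"
    proof -
      have "k \<oplus> b \<in> Fz (int j)"
        using subsetD[OF H_Fil k(1)] assms(2) Z.F_add by (simp add: Fil_Fz)
      then show ?thesis using Z.F_mult[of h "int i - 1" "k \<oplus> b" "int j"] h(1)
        by (simp add: Fil_pred_Fz algebra_simps)
    qed
    moreover have "a \<otimes> k \<in> Fz (int (i + j) - 1)"
      using Z.F_mult[of a "int i" k "int j - 1"] assms(1) k(1)
      by (simp add: Fil_pred_Fz Fil_Fz algebra_simps)
    ultimately have "h \<otimes> (k \<oplus> b) \<oplus> a \<otimes> k \<in> H (i + j)"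
      unfolding Fil_pred_Fz by (rule Z.F_add)
    moreover have "a' \<otimes> b' = (h \<otimes> (k \<oplus> b) \<oplus> a \<otimes> k) \<oplus> a \<otimes> b"
      unfolding h k using ab hk by algebra
    ultimately have "a' \<otimes> b' \<in> H (i + j) +> (a \<otimes> b)" by (auto simp: a_r_coset_def')
    then show ?thesis using coset_eq ab by simp
  qed
  moreover have "a \<in> H i +> a" "b \<in> H j +> b"
    using abelian_subgroup.a_rcos_self[OF H_abelian_subgroup] ab by auto
  ultimately show ?thesis unfolding rcoset_mult_def by blast
qed

lemma Gr_carrierD:
  assumes "x \<in> carrier Gr"
  obtains a where "a \<in> Fil i" "x i = H i +> a"
proof -
  have "x i \<in> carrier (gr_piece A Fil i)" using assms by (simp add: assoc_graded_def)
  then show ?thesis using that unfolding gr_piece_carrier by blast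
qed

text \<open>The elements of the associated graded ring whose component of degree \<open>i\<close>, a coset, is contained in
  \<open>M i\<close>.\<close>

definition gr_left_ideal :: "(int \<Rightarrow> _ set) \<Rightarrow> (nat \<Rightarrow> _ set) set" where
  "gr_left_ideal M = {x \<in> carrier Gr. \<forall>i. x i \<subseteq> M (int i)}"

text \<open>Families of subgroups between \<open>Fz (n - 1)\<close> and \<open>Fz n\<close> that correspond to homogeneous left ideals of the
  associated graded ring.\<close>

definition left_stable :: "(int \<Rightarrow> _ set) \<Rightarrow> bool" where
  "left_stable M \<longleftrightarrow> (\<forall>n. additive_subgroup (M n) A \<and> Fz (n - 1) \<subseteq> M n \<and> M n \<subseteq> Fz n)
     \<and> (\<forall>m n. \<forall>a \<in> Fz m. \<forall>x \<in> M n. a \<otimes> x \<in> M (m + n))"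

lemma left_stableI:
  assumes "\<And>n. additive_subgroup (M n) A" "\<And>n. Fz (n - 1) \<subseteq> M n" "\<And>n. M n \<subseteq> Fz n"
    and "\<And>a x m n. \<lbrakk>a \<in> Fz m; x \<in> M n\<rbrakk> \<Longrightarrow> a \<otimes> x \<in> M (m + n)"
  shows "left_stable M"
  unfolding left_stable_def using assms(1-3) by (intro conjI allI ballI assms(4))

lemma gr_finprod_subset:
  assumes "additive_subgroup N A" "H n \<subseteq> N" "finite I"
    and "\<And>i. i \<in> I \<Longrightarrow> f i \<in> carrier (gr_piece A Fil n) \<and> f i \<subseteq> N"
  shows "finprod (gr_piece A Fil n) f I \<subseteq> N"
  using assms(3,4)
proof (induction I rule: finite_induct)
  interpret G: comm_group "gr_piece A Fil n" by (rule gr_piece_comm_group)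
  case empty
  then show ?case using assms(2) by (simp add: gr_piece_one)
next
  interpret G: comm_group "gr_piece A Fil n" by (rule gr_piece_comm_group)
  case (insert i I)
  then have "finprod (gr_piece A Fil n) f (insert i I) = f i <+>\<^bsub>A\<^esub> finprod (gr_piece A Fil n) f I"
    by (subst G.finprod_insert) (auto simp: gr_piece_mult)
  also have "\<dots> \<subseteq> N"
  proof -
    have "f i \<subseteq> N" "finprod (gr_piece A Fil n) f I \<subseteq> N" using insert by simp_all
    then show ?thesis using additive_subgroup.a_closed[OF assms(1)] by (auto simp: set_add_def')
  qed
  finally show ?case .
qed

lemma left_ideal_gr_left_ideal:
  assumes "ring Gr" "left_stable M"
  shows "left_ideal (gr_left_ideal M) Gr"
proof -
  interpret Gr: ring Gr by fact
  have M: "additive_subgroup (M n) A" "Fz (n - 1) \<subseteq> M n" "M n \<subseteq> Fz n"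
    "\<And>a x. a \<in> Fz m \<Longrightarrow> x \<in> M n \<Longrightarrow> a \<otimes> x \<in> M (m + n)" for m n
    using assms(2) by (simp_all add: left_stable_def)
  have mult: "y \<otimes>\<^bsub>Gr\<^esub> x \<in> gr_left_ideal M" if y: "y \<in> carrier Gr" and x: "x \<in> gr_left_ideal M" for x y
  proof -
    have xc: "x \<in> carrier Gr" and xM: "\<And>i. x i \<subseteq> M (int i)" using x by (auto simp: gr_left_ideal_def)
    have "(y \<otimes>\<^bsub>Gr\<^esub> x) n \<subseteq> M (int n)" for n
    proof -
      have "(y \<otimes>\<^bsub>Gr\<^esub> x) n = finprod (gr_piece A Fil n) (\<lambda>i. rcoset_mult A (H n) (y i) (x (n - i))) {..n}"
        by (simp add: assoc_graded_def)
      also have "\<dots> \<subseteq> M (int n)"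
      proof (rule gr_finprod_subset[OF M(1)])
        show "H n \<subseteq> M (int n)" using M(2) by (simp add: Fil_pred_Fz)
        fix i assume i: "i \<in> {..n}"
        obtain a where a: "a \<in> Fil i" "y i = H i +> a" using Gr_carrierD[OF y] .
        obtain b where b: "b \<in> Fil (n - i)" "x (n - i) = H (n - i) +> b" using Gr_carrierD[OF xc] .
        have bc: "b \<in> carrier A" using b Z.F_carrier by (simp add: Fil_Fz)
        have eq: "rcoset_mult A (H n) (y i) (x (n - i)) = H n +> (a \<otimes> b)"
          using rcoset_mult_gr[OF a(1) b(1)] i a b by simp
        have "a \<otimes> b \<in> Fil n" using Fil_mult[OF a(1) b(1)] i by simp
        moreover have "b \<in> M (int (n - i))"
          using xM[of "n - i"] b abelian_subgroup.a_rcos_self[OF H_abelian_subgroup bc] by auto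
        then have "a \<otimes> b \<in> M (int n)" using M(4)[of a "int i" b "int (n - i)"] a i by (simp add: Fil_Fz)
        then have "H n +> (a \<otimes> b) \<subseteq> M (int n)"
          using M(2)[of "int n"] additive_subgroup.a_closed[OF M(1)]
          by (auto simp: a_r_coset_def' Fil_pred_Fz)
        ultimately show "rcoset_mult A (H n) (y i) (x (n - i)) \<in> carrier (gr_piece A Fil n)
            \<and> rcoset_mult A (H n) (y i) (x (n - i)) \<subseteq> M (int n)"
          unfolding eq gr_piece_carrier by blast
      qed simp
      finally show ?thesis .
    qed
    then show ?thesis using y xc by (simp add: gr_left_ideal_def)
  qed
  have sub: "gr_left_ideal M \<subseteq> carrier Gr" by (auto simp: gr_left_ideal_def)
  show ?thesis
  proof (intro left_ideal.intro left_ideal_axioms.intro)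
    show "additive_subgroup (gr_left_ideal M) Gr"
    proof (rule additive_subgroupI, rule Gr.add.subgroupI)
      have "\<zero>\<^bsub>Gr\<^esub> i \<subseteq> M (int i)" for i using M(2) by (simp add: assoc_graded_def Fil_pred_Fz)
      then have "\<zero>\<^bsub>Gr\<^esub> \<in> gr_left_ideal M" by (simp add: gr_left_ideal_def)
      then show "gr_left_ideal M \<noteq> {}" by blast
    next
      fix x assume x: "x \<in> gr_left_ideal M"
      \<comment> \<open>Negatives are left multiples by \<open>-1\<close>.\<close>
      have "\<ominus>\<^bsub>Gr\<^esub> x = (\<ominus>\<^bsub>Gr\<^esub> \<one>\<^bsub>Gr\<^esub>) \<otimes>\<^bsub>Gr\<^esub> x" using x sub by (simp add: Gr.l_minus subset_iff)
      then show "\<ominus>\<^bsub>Gr\<^esub> x \<in> gr_left_ideal M" using mult[OF _ x] by simp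
    next
      fix x y assume xy: "x \<in> gr_left_ideal M" "y \<in> gr_left_ideal M"
      have "(x \<oplus>\<^bsub>Gr\<^esub> y) i \<subseteq> M (int i)" for i
      proof -
        have "(x \<oplus>\<^bsub>Gr\<^esub> y) i = x i <+>\<^bsub>A\<^esub> y i" by (simp add: assoc_graded_def)
        then show ?thesis using xy additive_subgroup.a_closed[OF M(1)]
          by (auto simp: gr_left_ideal_def set_add_def' subset_iff)
      qed
      then show "x \<oplus>\<^bsub>Gr\<^esub> y \<in> gr_left_ideal M" using xy sub by (auto simp: gr_left_ideal_def)
    qed (use sub in simp)
  qed (use mult Gr.ring_axioms in auto)
qed

lemma one_Fz: "\<one> \<in> Fz 0"
  using Fil_scalars[of "\<one>\<^bsub>K\<^esub>"] by (simp add: Fz_def)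

text \<open>If the left ideal attached to \<open>M\<close> is generated by a finite set \<open>S\<close> of sequences, then representatives of
  the nonzero components of the members of \<open>S\<close> span \<open>M\<close>: the span is itself a family of the same kind, and
  its left ideal contains \<open>S\<close>.\<close>

lemma left_stable_fin_gen:
  assumes noeth: "left_right_noetherian_ring Gr" and M: "left_stable M"
  shows "\<exists>zs. (\<forall>(z, c) \<in> set zs. z \<in> M c \<and> 0 \<le> c \<and> z \<notin> Fz (c - 1)) \<and> (\<forall>n. M n \<subseteq> Z.hspan zs n)"
proof -
  have ring: "ring Gr" using noeth by (rule left_right_noetherian_ring.axioms)
  have MM: "additive_subgroup (M n) A" "Fz (n - 1) \<subseteq> M n" "M n \<subseteq> Fz n" for n
    using M by (simp_all add: left_stable_def)
  obtain S where S: "S \<subseteq> carrier Gr" "finite S" "gr_left_ideal M = genleftideal Gr S"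
    using left_right_noetherian_ring.left_fin_gen[OF noeth left_ideal_gr_left_ideal[OF ring M]] by blast
  have SM: "S \<subseteq> gr_left_ideal M" unfolding S(3) genleftideal_def by blast
  define Z where "Z = (\<Union>x \<in> S. (\<lambda>i. (SOME z. z \<in> x i, int i)) ` {i. x i \<noteq> H i})"
  have "finite {i. x i \<noteq> H i}" if "x \<in> S" for x
    using S(1) that by (auto simp: assoc_graded_def)
  then have "finite Z" unfolding Z_def using S(2) by blast
  then obtain zs where zs: "set zs = Z" using finite_list by blast
  have coset: "(SOME z. z \<in> x i) \<in> x i \<and> x i = H i +> (SOME z. z \<in> x i)" if x: "x \<in> carrier Gr" for x i
  proof -
    obtain a where a: "a \<in> Fil i" "x i = H i +> a" using Gr_carrierD[OF x] .
    have ac: "a \<in> carrier A" using a Z.F_carrier by (simp add: Fil_Fz)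
    have "a \<in> x i" unfolding a(2) by (rule abelian_subgroup.a_rcos_self[OF H_abelian_subgroup ac])
    then have "(SOME z. z \<in> x i) \<in> x i" by (rule someI)
    then show ?thesis using coset_eq[OF _ ac, of _ i] a(2) by simp
  qed
  have Z: "z \<in> M c \<and> 0 \<le> c \<and> z \<notin> Fz (c - 1)" if "(z, c) \<in> set zs" for z c
  proof -
    have "(z, c) \<in> Z" using that zs by simp
    then obtain x i where x: "x \<in> S" "x i \<noteq> H i" "z = (SOME z. z \<in> x i)" "c = int i"
      unfolding Z_def by blast
    have z: "z \<in> x i" "x i = H i +> z"
      using coset[OF subsetD[OF S(1) x(1)], of i] unfolding x(3) by (rule conjunct1, rule conjunct2)
    have "z \<notin> H i"
    proof
      assume "z \<in> H i"
      then have "H i +> z = H i" by (rule abelian_subgroup.a_rcos_const[OF H_abelian_subgroup])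
      with z(2) have "x i = H i" by (rule trans)
      with x(2) show False ..
    qed
    moreover have "z \<in> M (int i)" using z(1) x(1) SM by (auto simp: gr_left_ideal_def)
    ultimately show ?thesis using x by (simp add: Fil_pred_Fz)
  qed
  have zF: "z \<in> Fz c" if "(z, c) \<in> set zs" for z c using Z[OF that] MM(3)[of c] by auto
  have zc: "fst ` set zs \<subseteq> carrier A" using Z.F_carrier[OF zF] by auto
  have N: "left_stable (Z.hspan zs)"
  proof (rule left_stableI)
    show "additive_subgroup (Z.hspan zs n) A" for n by (rule Z.hspan_subgroup[OF zc])
    show "Fz (n - 1) \<subseteq> Z.hspan zs n" for n by (rule subsetI) (rule Z.hspan_base[OF zc])
    show "Z.hspan zs n \<subseteq> Fz n" for n by (rule subsetI) (rule Z.hspan_subset[OF zF])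
    show "a \<otimes> x \<in> Z.hspan zs (m + n)" if "a \<in> Fz m" "x \<in> Z.hspan zs n" for a x m n
      by (rule Z.hspan_mult_left[OF zc that])
  qed
  have "x i \<subseteq> Z.hspan zs (int i)" if x: "x \<in> S" for x i
  proof (cases "x i = H i")
    case True
    then show ?thesis using Z.hspan_base[OF zc] by (auto simp: Fil_pred_Fz)
  next
    case False
    define z where "z = (SOME z. z \<in> x i)"
    have xi: "x i = H i +> z"
      using coset[OF subsetD[OF S(1) x], of i] unfolding z_def by (rule conjunct2)
    have zin: "(z, int i) \<in> set zs" using False x by (auto simp: zs Z_def z_def)
    then have "\<one> \<otimes> z \<in> Z.hspan zs (int i)" using one_Fz by (intro Z.hspan_member[OF zc]) auto
    then have "z \<in> Z.hspan zs (int i)" using Z.F_carrier[OF zF[OF zin]] by simp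
    then show ?thesis unfolding xi
      using Z.hspan_add[OF zc] Z.hspan_base[OF zc] by (auto simp: a_r_coset_def' Fil_pred_Fz)
  qed
  then have "S \<subseteq> gr_left_ideal (Z.hspan zs)" using S(1) by (auto simp: gr_left_ideal_def)
  then have sub: "gr_left_ideal M \<subseteq> gr_left_ideal (Z.hspan zs)"
    unfolding S(3) genleftideal_def using left_ideal_gr_left_ideal[OF ring N] by blast
  have "M n \<subseteq> Z.hspan zs n" for n
  proof
    fix m assume m: "m \<in> M n"
    show "m \<in> Z.hspan zs n"
    proof (cases "n < 0")
      case True
      then have "m = \<zero>" using subsetD[OF MM(3) m] by (simp add: Fz_def)
      then show ?thesis using Z.hspan_base[OF zc Z.F_zero] by simp
    next
      case False
      define i where "i = nat n"
      have n: "n = int i" using False by (simp add: i_def)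
      \<comment> \<open>The homogeneous sequence with the class of \<open>m\<close> in degree \<open>i\<close>.\<close>
      define x where "x = (\<lambda>j. if j = i then H i +> m else H j)"
      have mF: "m \<in> Fil i" using m MM(3) n by (auto simp: Fil_Fz)
      have mc: "m \<in> carrier A" using mF Z.F_carrier by (simp add: Fil_Fz)
      have "H j \<in> carrier (gr_piece A Fil j)" for j
        using monoid.one_closed[OF comm_monoid.axioms(1)[OF comm_group.axioms(1)[OF gr_piece_comm_group]]]
        by (simp add: gr_piece_one)
      then have "x j \<in> carrier (gr_piece A Fil j)" for j
        using mF by (auto simp: x_def gr_piece_carrier)
      moreover have "finite {j. x j \<noteq> H j}"
        by (rule finite_subset[of _ "{i}"]) (auto simp: x_def)
      ultimately have "x \<in> carrier Gr" by (simp add: assoc_graded_def)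
      moreover have "x j \<subseteq> M (int j)" for j
        using MM(2)[of "int j"] m n additive_subgroup.a_closed[OF MM(1)]
        by (auto simp: x_def a_r_coset_def' Fil_pred_Fz)
      ultimately have "x \<in> gr_left_ideal M" by (simp add: gr_left_ideal_def)
      then have "x i \<subseteq> Z.hspan zs n" using sub n by (auto simp: gr_left_ideal_def)
      moreover have "m \<in> x i"
        using abelian_subgroup.a_rcos_self[OF H_abelian_subgroup mc] by (simp add: x_def)
      ultimately show ?thesis by blast
    qed
  qed
  then show ?thesis using Z by blast
qed

text \<open>Homogeneous generators of the positive part of the associated graded ring, with a bound for their
  syzygies.\<close>

lemma bounded_generators:
  assumes noeth: "left_right_noetherian_ring Gr"
  shows "\<exists>ys e. 0 \<le> e \<and> Z.bounded_syz e ys \<and> (\<forall>n. 1 \<le> n \<longrightarrow> Fz n \<subseteq> Z.hspan ys n)"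
proof -
  \<comment> \<open>The positive part of the associated graded ring. Its component of degree \<open>0\<close> is zero, which forces
    the generators into positive degrees.\<close>
  define M where "M n = (if 1 \<le> n then Fz n else Fz (n - 1))" for n
  have neg: "x = \<zero>" if "x \<in> Fz n" "n < 0" for x n using that by (simp add: Fz_def)
  have "left_stable M"
  proof (rule left_stableI)
    show "additive_subgroup (M n) A" for n unfolding M_def by (simp add: Z.F_subgroup)
    show "Fz (n - 1) \<subseteq> M n" for n
      unfolding M_def by (rule subsetI) (simp add: Z.F_mono[of "n - 1" n])
    show "M n \<subseteq> Fz n" for n
      unfolding M_def by (rule subsetI) (simp add: Z.F_mono[of "n - 1" n] split: if_splits)
    fix a x m n assume a: "a \<in> Fz m" and x: "x \<in> M n"
    have c: "a \<in> carrier A" "x \<in> carrier A"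
      using a x Z.F_carrier[of a m] Z.F_carrier[of x n] Z.F_carrier[of x "n - 1"]
      by (auto simp: M_def split: if_splits)
    have zero: "\<zero> \<in> M (m + n)" by (simp add: M_def Z.F_zero)
    show "a \<otimes> x \<in> M (m + n)"
    proof (cases "0 \<le> m \<and> 1 \<le> n")
      case True
      then show ?thesis using Z.F_mult[OF a, of x n] x by (simp add: M_def)
    next
      case False
      have "a = \<zero> \<or> x = \<zero>"
      proof (cases "m < 0")
        case True then show ?thesis using neg[OF a] by simp
      next
        case m: False
        then have "x \<in> Fz (n - 1)" "n - 1 < 0" using False x by (simp_all add: M_def)
        then show ?thesis using neg by simp
      qed
      then show ?thesis using c zero by auto
    qed
  qed
  from left_stable_fin_gen[OF noeth this] obtain ys where
    ys: "\<forall>(z, c) \<in> set ys. z \<in> M c \<and> 0 \<le> c \<and> z \<notin> Fz (c - 1)" "\<forall>n. M n \<subseteq> Z.hspan ys n"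
    by (elim exE conjE)
  have "y \<in> Fz d \<and> 1 \<le> d" if "(y, d) \<in> set ys" for y d
  proof -
    have "y \<in> M d" "y \<notin> Fz (d - 1)" using ys(1) that by auto
    then show ?thesis by (simp add: M_def split: if_splits)
  qed
  from Z.bounded_syz_exists[OF left_stable_fin_gen[OF noeth left_stableI] this]
  obtain e where "Z.bounded_syz e ys" by blast
  then have "Z.bounded_syz (max e 0) ys" by (rule Z.bounded_syz_mono) simp
  moreover have "Fz n \<subseteq> Z.hspan ys n" if "1 \<le> n" for n using ys(2)[rule_format, of n] that by (simp add: M_def)
  ultimately show ?thesis by (intro exI[of _ ys] exI[of _ "max e 0"]) simp
qed

end

section \<open>Finite presentation\<close>

context fin_dim_filtration begin

lemma Fil_finite_span:
  obtains B where "finite B" "B \<subseteq> Fil i" "span B = Fil i"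
proof -
  have sub: "submodule K (Fil i) A" by (rule subspace.submod[OF Fil_subspace])
  interpret V: vectorspace K "A\<lparr>carrier := Fil i\<rparr>" by (rule subspace_is_vs[OF Fil_subspace])
  obtain B where B: "finite B" "B \<subseteq> Fil i" "LinearCombinations.module.span K (A\<lparr>carrier := Fil i\<rparr>) B = Fil i"
    using Fil_fin_dim[of i] unfolding V.fin_dim_def by auto
  then show ?thesis using that span_li_not_depend(1)[OF B(2) sub] by simp
qed

text \<open>Every step of the filtration is the set of values of the linear forms in finitely many variables.\<close>

lemma Fil_generating_sequence:
  obtains n g where "word_evaluation K A g" "word_evaluation.eval K A g ` short_words n 1 = Fil i"
proof -
  obtain B where B: "finite B" "B \<subseteq> Fil i" "span B = Fil i" by (rule Fil_finite_span)
  obtain bs where bs: "set bs = B" using finite_list[OF B(1)] by blast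
  define n where "n = length bs"
  define g where "g j = (if j < n then bs ! j else \<zero>)" for j
  have sub: "submodule K (Fil i) A" by (rule subspace.submod[OF Fil_subspace])
  interpret S: submodule K "Fil i" A by (rule sub)
  have gFil: "g j \<in> Fil i" for j
    using B(2) bs S.zero_closed by (auto simp: g_def n_def)
  interpret W: word_evaluation K A g
    using gFil S.subset by unfold_locales auto
  let ?L = "short_words n 1"
  have Lc: "p \<in> carrier (free_algebra K n)" if "p \<in> ?L" for p using that by (simp add: short_words_def)
  have image: "submodule K (W.eval ` ?L) A"
  proof
    show "W.eval ` ?L \<subseteq> carrier A" using W.eval_closed[OF Lc] by blast
    have "(\<lambda>w. \<zero>\<^bsub>K\<^esub>) \<in> ?L" by (simp add: short_words_def zero_in_free_algebra)
    then show "\<zero> \<in> W.eval ` ?L" using W.eval_zero by (metis imageI)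
    show "v \<oplus> w \<in> W.eval ` ?L" if vw: "v \<in> W.eval ` ?L" "w \<in> W.eval ` ?L" for v w
    proof -
      from vw obtain p q where pq: "p \<in> ?L" "q \<in> ?L" "v = W.eval p" "w = W.eval q" by (elim imageE)
      then have "v \<oplus> w = W.eval (\<lambda>w. p w \<oplus>\<^bsub>K\<^esub> q w)" using W.eval_add[OF Lc Lc] by simp
      then show ?thesis using short_words_add[OF pq(1,2)] by (rule image_eqI)
    qed
    show "c \<odot> v \<in> W.eval ` ?L" if c: "c \<in> carrier K" and v: "v \<in> W.eval ` ?L" for c v
    proof -
      from v obtain p where p: "p \<in> ?L" "v = W.eval p" by (elim imageE)
      then have "c \<odot> v = W.eval (\<lambda>w. c \<otimes>\<^bsub>K\<^esub> p w)" using W.eval_smult[OF c Lc] by simp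
      then show ?thesis using short_words_smult[OF c p(1)] by (rule image_eqI)
    qed
  qed
  have "B \<subseteq> W.eval ` ?L"
  proof
    fix b assume "b \<in> B"
    then obtain j where j: "j < n" "b = g j" using bs by (auto simp: in_set_conv_nth g_def n_def)
    have "b = W.eval (word_monom \<one>\<^bsub>K\<^esub> [j])"
      using W.g_closed[of j] j by (simp add: W.eval_word_monom W.word_val_def)
    then show "b \<in> W.eval ` ?L" using word_monom_short[of "\<one>\<^bsub>K\<^esub>" "[j]" n 1] j(1) by (intro image_eqI) auto
  qed
  then have "Fil i \<subseteq> W.eval ` ?L" using span_is_subset[OF _ image, of B] B(3) by simp
  moreover have "W.eval p \<in> Fil i" if p: "p \<in> ?L" for p
  proof -
    have summand: "p w \<odot> W.word_val w \<in> Fil i" if "p w \<noteq> \<zero>\<^bsub>K\<^esub>" for w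
    proof -
      have "length w \<le> 1" using p that by (simp add: short_words_def)
      then consider "w = []" | j where "w = [j]" by (cases w) auto
      then show ?thesis
      proof cases
        case 1
        \<comment> \<open>The constant term: scalars lie in every step of the filtration.\<close>
        have "Fil 0 \<subseteq> Fil i" unfolding subset_iff Fil_Fz using Z.F_mono[of "int 0" "int i"] by simp
        then show ?thesis
          using Fil_scalars free_algebra_coeff[OF Lc[OF p]] 1 by (auto simp: W.word_val_def)
      next
        case (2 j)
        then have "W.word_val w = g j" using W.g_closed[of j] by (simp add: W.word_val_def)
        then show ?thesis using S.smult_closed[OF free_algebra_coeff[OF Lc[OF p]] gFil] by simp
      qed
    qed
    have "(\<Oplus>w \<in> X. p w \<odot> W.word_val w) \<in> Fil i" if "finite X" "\<And>w. w \<in> X \<Longrightarrow> p w \<noteq> \<zero>\<^bsub>K\<^esub>" for X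
      using that
    proof (induction X rule: finite_induct)
      case empty then show ?case using S.zero_closed by simp
    next
      case (insert w X)
      have "(\<Oplus>w \<in> insert w X. p w \<odot> W.word_val w) = p w \<odot> W.word_val w \<oplus> (\<Oplus>w \<in> X. p w \<odot> W.word_val w)"
        using insert W.word_val_closed free_algebra_coeff[OF Lc[OF p]] by (intro M.finsum_insert) auto
      also have "\<dots> \<in> Fil i" using insert summand by (intro S.m_closed) auto
      finally show ?case .
    qed
    from this[OF free_algebraD(2)[OF Lc[OF p]]] show ?thesis unfolding W.eval_def by simp
  qed
  ultimately have "W.eval ` ?L = Fil i" by blast
  then show ?thesis using that[OF W.word_evaluation_axioms] by blast
qed

end

context word_evaluation begin

text \<open>The relations among words of length at most two.\<close>

definition short_relations :: "nat \<Rightarrow> _" where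
  "short_relations n = {p \<in> short_words n 2. eval p = \<zero>}"

text \<open>Ideals of the free algebra are closed under scalars, as a scalar is a multiple of the unit; so a
  finite spanning set of the space of short relations generates an ideal containing all of them.\<close>

lemma short_relations_finite_span:
  obtains S where "S \<subseteq> short_relations n" "finite S"
    "short_relations n \<subseteq> Idl\<^bsub>free_algebra K n\<^esub> S"
proof -
  interpret P: ring "free_algebra K n" by (rule ring_free_algebra)
  let ?T = "short_relations n"
  let ?X = "{w. set w \<subseteq> {..<n} \<and> length w \<le> 2}"
  have Tc: "p \<in> carrier (free_algebra K n)" if "p \<in> ?T" for p
    using that by (simp add: short_relations_def short_words_def)
  have "\<exists>S \<subseteq> ?T. finite S \<and> (\<forall>J. S \<subseteq> J \<and> (\<lambda>w. \<zero>\<^bsub>K\<^esub>) \<in> J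
      \<and> (\<forall>p \<in> J. \<forall>q \<in> J. (\<lambda>w. p w \<oplus>\<^bsub>K\<^esub> q w) \<in> J)
      \<and> (\<forall>c \<in> carrier K. \<forall>p \<in> J. (\<lambda>w. c \<otimes>\<^bsub>K\<^esub> p w) \<in> J) \<longrightarrow> ?T \<subseteq> J)"
  proof (rule finite_spanning_subset[OF field_axioms])
    show "finite ?X" by (rule finite_lists_length_le) simp
    show "?T \<subseteq> {p. (\<forall>w. p w \<in> carrier K) \<and> (\<forall>w. p w \<noteq> \<zero>\<^bsub>K\<^esub> \<longrightarrow> w \<in> ?X)}"
    proof
      fix p assume p: "p \<in> ?T"
      then show "p \<in> {p. (\<forall>w. p w \<in> carrier K) \<and> (\<forall>w. p w \<noteq> \<zero>\<^bsub>K\<^esub> \<longrightarrow> w \<in> ?X)}"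
        using free_algebra_coeff[OF Tc[OF p]] free_algebraD(3)[OF Tc[OF p]]
        by (simp add: short_relations_def short_words_def)
    qed
    show "(\<lambda>w. p w \<oplus>\<^bsub>K\<^esub> q w) \<in> ?T" if "p \<in> ?T" "q \<in> ?T" for p q
      using that short_words_add eval_add[OF Tc Tc, OF that] by (simp add: short_relations_def)
    show "(\<lambda>w. c \<otimes>\<^bsub>K\<^esub> p w) \<in> ?T" if "c \<in> carrier K" "p \<in> ?T" for c p
      using that short_words_smult eval_smult[OF that(1) Tc, OF that(2)] by (simp add: short_relations_def)
  qed
  then obtain S where S: "S \<subseteq> ?T" "finite S" and SJ: "\<And>J. \<lbrakk>S \<subseteq> J; (\<lambda>w. \<zero>\<^bsub>K\<^esub>) \<in> J;
      \<forall>p \<in> J. \<forall>q \<in> J. (\<lambda>w. p w \<oplus>\<^bsub>K\<^esub> q w) \<in> J;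
      \<forall>c \<in> carrier K. \<forall>p \<in> J. (\<lambda>w. c \<otimes>\<^bsub>K\<^esub> p w) \<in> J\<rbrakk> \<Longrightarrow> ?T \<subseteq> J" by auto
  have Sc: "S \<subseteq> carrier (free_algebra K n)" using S(1) Tc by blast
  interpret J: ideal "Idl\<^bsub>free_algebra K n\<^esub> S" "free_algebra K n" by (rule P.genideal_ideal[OF Sc])
  have "?T \<subseteq> Idl\<^bsub>free_algebra K n\<^esub> S"
  proof (rule SJ)
    show "S \<subseteq> Idl\<^bsub>free_algebra K n\<^esub> S" by (rule P.genideal_self[OF Sc])
    show "(\<lambda>w. \<zero>\<^bsub>K\<^esub>) \<in> Idl\<^bsub>free_algebra K n\<^esub> S" using J.zero_closed by (simp add: free_algebra_simps(4))
    show "\<forall>p \<in> Idl\<^bsub>free_algebra K n\<^esub> S. \<forall>q \<in> Idl\<^bsub>free_algebra K n\<^esub> S.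
        (\<lambda>w. p w \<oplus>\<^bsub>K\<^esub> q w) \<in> Idl\<^bsub>free_algebra K n\<^esub> S"
      using J.a_closed by (simp add: free_algebra_simps(5))
    show "\<forall>c \<in> carrier K. \<forall>p \<in> Idl\<^bsub>free_algebra K n\<^esub> S. (\<lambda>w. c \<otimes>\<^bsub>K\<^esub> p w) \<in> Idl\<^bsub>free_algebra K n\<^esub> S"
    proof (intro ballI)
      fix c p assume c: "c \<in> carrier K" and p: "p \<in> Idl\<^bsub>free_algebra K n\<^esub> S"
      have "word_monom c [] \<otimes>\<^bsub>free_algebra K n\<^esub> p \<in> Idl\<^bsub>free_algebra K n\<^esub> S"
        using c by (intro J.I_l_closed[OF p] word_monom_in_free_algebra) auto
      then show "(\<lambda>w. c \<otimes>\<^bsub>K\<^esub> p w) \<in> Idl\<^bsub>free_algebra K n\<^esub> S"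
        using free_algebra_smult_eq[OF c J.Icarr[OF p]] by (simp add: free_algebra_simps(6))
    qed
  qed
  then show ?thesis using that S by blast
qed

lemma alg_iso_of_kernel:
  assumes ker: "a_kernel (free_algebra K n) A eval = J"
    and surj: "eval ` carrier (free_algebra K n) = carrier A"
  shows "alg_iso K A (quot_algebra (free_algebra K n) J) \<noteq> {}"
proof -
  let ?P = "free_algebra K n"
  interpret P: ring ?P by (rule ring_free_algebra)
  interpret E: ring_hom_ring ?P A eval by (rule eval_ring_hom)
  interpret J: ideal J ?P using E.kernel_is_ideal ker by simp
  let ?f = "\<lambda>X. the_elem (eval ` X)"
  have f: "?f \<in> ring_iso (?P Quot J) A" using E.FactRing_iso_set[OF surj] ker by simp
  \<comment> \<open>The inverse of the isomorphism induced by \<open>eval\<close>; it sends \<open>eval p\<close> to the coset of \<open>p\<close>.\<close>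
  define h where "h = inv_into (carrier (?P Quot J)) ?f"
  have h: "h \<in> ring_iso A (?P Quot J)"
    unfolding h_def by (rule ring_iso_set_sym[OF J.quotient_is_ring f])
  have inj: "inj_on ?f (carrier (?P Quot J))" using f by (simp add: ring_iso_def bij_betw_def)
  have h_eval: "h (eval p) = J +>\<^bsub>?P\<^esub> p" if p: "p \<in> carrier ?P" for p
  proof -
    have "J +>\<^bsub>?P\<^esub> p \<in> carrier (?P Quot J)"
      using P.a_rcosetsI[OF J.a_subset p] by (simp add: FactRing_def)
    moreover have "?f (J +>\<^bsub>?P\<^esub> p) = eval p" using E.the_elem_simp[OF p] ker by simp
    ultimately show ?thesis unfolding h_def using inv_into_f_f[OF inj] by metis
  qed
  have "h \<in> ring_iso A (quot_algebra ?P J)"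
    using h by (simp add: ring_iso_def ring_hom_def quot_algebra_def)
  moreover have "h (c \<odot> x) = c \<odot>\<^bsub>quot_algebra ?P J\<^esub> h x" if c: "c \<in> carrier K" and x: "x \<in> carrier A" for c x
  proof -
    obtain p where p: "p \<in> carrier ?P" "x = eval p" using x surj by blast
    let ?m = "word_monom c []"
    have m: "?m \<in> carrier ?P" using c by (intro word_monom_in_free_algebra) auto
    have cp: "c \<odot>\<^bsub>?P\<^esub> q = ?m \<otimes>\<^bsub>?P\<^esub> q" if "q \<in> carrier ?P" for q
      by (rule free_algebra_smult_eq[OF c that])
    have "c \<odot> x = eval (c \<odot>\<^bsub>?P\<^esub> p)" using eval_smult[OF c p(1)] p(2) by (simp add: free_algebra_simps(6))
    moreover have cpc: "c \<odot>\<^bsub>?P\<^esub> p \<in> carrier ?P" using cp[OF p(1)] m p(1) by simp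
    ultimately have lhs: "h (c \<odot> x) = J +>\<^bsub>?P\<^esub> (c \<odot>\<^bsub>?P\<^esub> p)" using h_eval by simp
    have "J +>\<^bsub>?P\<^esub> (c \<odot>\<^bsub>?P\<^esub> q) = J +>\<^bsub>?P\<^esub> (c \<odot>\<^bsub>?P\<^esub> p)" if q: "q \<in> J +>\<^bsub>?P\<^esub> p" for q
    proof -
      obtain j where j: "j \<in> J" "q = j \<oplus>\<^bsub>?P\<^esub> p" using q by (auto simp: a_r_coset_def')
      have jc: "j \<in> carrier ?P" by (rule J.Icarr[OF j(1)])
      have "c \<odot>\<^bsub>?P\<^esub> q = ?m \<otimes>\<^bsub>?P\<^esub> j \<oplus>\<^bsub>?P\<^esub> c \<odot>\<^bsub>?P\<^esub> p"
        using cp[of q] cp[OF p(1)] jc p(1) m j(2) by (simp add: P.r_distr)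
      moreover have "?m \<otimes>\<^bsub>?P\<^esub> j \<in> J" by (rule J.I_l_closed[OF j(1) m])
      ultimately have "c \<odot>\<^bsub>?P\<^esub> q \<in> J +>\<^bsub>?P\<^esub> (c \<odot>\<^bsub>?P\<^esub> p)" by (auto simp: a_r_coset_def')
      then show ?thesis using J.a_repr_independence'[OF _ cpc] by simp
    qed
    moreover have "p \<in> J +>\<^bsub>?P\<^esub> p" by (rule J.a_rcos_self[OF p(1)])
    ultimately have "(\<Union>q \<in> J +>\<^bsub>?P\<^esub> p. J +>\<^bsub>?P\<^esub> (c \<odot>\<^bsub>?P\<^esub> q)) = J +>\<^bsub>?P\<^esub> (c \<odot>\<^bsub>?P\<^esub> p)" by blast
    then show ?thesis using lhs h_eval[OF p(1)] p(2) by (simp add: quot_algebra_def)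
  qed
  ultimately show ?thesis by (auto simp: alg_iso_def)
qed

end

theorem (in fin_dim_filtration) finitely_presented:
  assumes noeth: "left_right_noetherian_ring (assoc_graded A Fil)"
  shows "finitely_presented_algebra K A"
proof -
  obtain ys e where e: "0 \<le> e" "Z.bounded_syz e ys" "\<And>n. 1 \<le> n \<Longrightarrow> Fz n \<subseteq> Z.hspan ys n"
    using bounded_generators[OF noeth] by auto
  obtain n g where W: "word_evaluation K A g"
    and L: "word_evaluation.eval K A g ` short_words n 1 = Fil (nat e)"
    by (rule Fil_generating_sequence)
  interpret W: word_evaluation K A g by (rule W)
  let ?P = "free_algebra K n"
  obtain S where S: "S \<subseteq> W.short_relations n" "finite S" "W.short_relations n \<subseteq> Idl\<^bsub>?P\<^esub> S"
    by (rule W.short_relations_finite_span)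
  let ?J = "Idl\<^bsub>?P\<^esub> S"
  interpret P: ring ?P by (rule ring_free_algebra)
  interpret E: ring_hom_ring ?P A W.eval by (rule W.eval_ring_hom)
  have Sc: "S \<subseteq> carrier ?P" using S(1) by (auto simp: W.short_relations_def short_words_def)
  have ideal_genideal: "ideal ?J ?P" by (rule P.genideal_ideal[OF Sc])
  have "S \<subseteq> a_kernel ?P A W.eval"
  proof
    fix p assume p: "p \<in> S"
    have "W.eval p = \<zero>" using subsetD[OF S(1) p] unfolding W.short_relations_def by blast
    with subsetD[OF Sc p] show "p \<in> a_kernel ?P A W.eval" unfolding a_kernel_def' by blast
  qed
  then have Jker: "?J \<subseteq> a_kernel ?P A W.eval" by (rule P.genideal_minimal[OF E.kernel_is_ideal])
  have Lc: "p \<in> carrier ?P" if "p \<in> short_words n k" for p k using that by (simp add: short_words_def)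
  \<comment> \<open>For \<open>p\<close>, \<open>q\<close>, \<open>r\<close> linear, \<open>p q - r\<close> involves words of length at most two only.\<close>
  interpret truncated_presentation A Fz ?P W.eval e "short_words n 1" ?J ys
  proof (intro truncated_presentation.intro truncated_presentation_axioms.intro)
    show "int_filtration A Fz" by (rule int_filtration_Fz)
    show "ring_hom_ring ?P A W.eval" by (rule W.eval_ring_hom)
    show "Fz m = {\<zero>}" if "m < 0" for m using that by (simp add: Fz_def)
    show "0 \<le> e" by (rule e(1))
    show "ideal ?J ?P" by (rule ideal_genideal)
    show "W.eval p = \<zero>" if "p \<in> ?J" for p using subsetD[OF Jker that] unfolding a_kernel_def' by blast
    show "additive_subgroup (short_words n 1) ?P" by (rule short_words_subgroup)
    show "\<one>\<^bsub>?P\<^esub> \<in> short_words n 1" using word_monom_short[of "\<one>\<^bsub>K\<^esub>" "[]" n 1] by (simp add: free_algebra_simps(3))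
    show "W.eval ` short_words n 1 = Fz e" using L e(1) by (simp add: Fz_def)
    show "carrier ?P \<subseteq> X" if "short_words n 1 \<subseteq> X"
      "\<And>p q. \<lbrakk>p \<in> X; q \<in> X\<rbrakk> \<Longrightarrow> p \<oplus>\<^bsub>?P\<^esub> q \<in> X" "\<And>p q. \<lbrakk>p \<in> X; q \<in> X\<rbrakk> \<Longrightarrow> p \<otimes>\<^bsub>?P\<^esub> q \<in> X" for X
      by (rule short_words_generate[OF that])
    show "Z.bounded_syz e ys" by (rule e(2))
    show "Fz m \<subseteq> Z.hspan ys m" if "1 \<le> m" for m by (rule e(3)[OF that])
    fix p q r assume pqr: "p \<in> short_words n 1" "q \<in> short_words n 1" "r \<in> short_words n 1"
      and eq: "W.eval p \<otimes> W.eval q = W.eval r"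
    note c = Lc[OF pqr(1)] Lc[OF pqr(2)] Lc[OF pqr(3)]
    interpret S2: additive_subgroup "short_words n 2" ?P by (rule short_words_subgroup)
    have "p \<otimes>\<^bsub>?P\<^esub> q \<in> short_words n 2"
      using short_words_conv[OF pqr(1,2)] by (simp add: free_algebra_simps(2) numeral_2_eq_2)
    moreover have "r \<in> short_words n 2" using short_words_mono[of 1 2 n] pqr(3) by auto
    ultimately have "p \<otimes>\<^bsub>?P\<^esub> q \<ominus>\<^bsub>?P\<^esub> r \<in> short_words n 2"
      unfolding a_minus_def by (intro S2.a_closed S2.a_inv_closed)
    moreover have "W.eval (p \<otimes>\<^bsub>?P\<^esub> q \<ominus>\<^bsub>?P\<^esub> r) = \<zero>"
      using c eq by (simp add: a_minus_def r_neg)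
    ultimately show "p \<otimes>\<^bsub>?P\<^esub> q \<ominus>\<^bsub>?P\<^esub> r \<in> ?J" using S(3) by (auto simp: W.short_relations_def)
  qed
  have "(\<Union>m. Fz m) = carrier A"
  proof
    show "(\<Union>m. Fz m) \<subseteq> carrier A" using Z.F_carrier by (rule UN_least[OF subsetI])
    show "carrier A \<subseteq> (\<Union>m. Fz m)"
    proof
      fix x assume "x \<in> carrier A"
      then obtain i where "x \<in> Fil i" using Fil_exhaustive by auto
      then have "x \<in> Fz (int i)" by (simp only: Fil_Fz)
      then show "x \<in> (\<Union>m. Fz m)" by (rule UN_I[OF UNIV_I])
    qed
  qed
  then have "alg_iso K A (quot_algebra ?P ?J) \<noteq> {}"
    using W.alg_iso_of_kernel[OF kernel_eq] image_eq by simp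
  then show ?thesis
    unfolding finitely_presented_algebra_def using ideal_genideal Sc S(2) by blast
qed

theorem theorem1p1:
  fixes F :: "('k, 'm) ring_scheme"
    and R :: "('k, 'a, 'p) module_scheme"
    and Fil :: "nat \<Rightarrow> 'a set"
  assumes "field F"
    and "assoc_algebra F R"
    and "fin_dim_filtration F R Fil"
    and "left_right_noetherian_ring (assoc_graded R Fil)"
  shows "finitely_presented_algebra F R"
  using assms(3,4) by (rule fin_dim_filtration.finitely_presented)

end
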